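(* Assume that the diffusion coefficients are constant, $\sigma_{i,j}(x)\equiv\sigma_{i,j}$ for all $i,j=1,\dots,d$, and that the system of SDEs $$\mathrm{d}X_i(t)=\Big\{\sum_{j\neq i}\frac{\gamma_{i,j}}{X_i(t)-X_j(t)}+b_i(X(t))\Big\}\mathrm{d}t+\sum_{j=1}^d\sigma_{i,j}\,\mathrm{d}W_j(t),\qquad i=1,\dots,d,$$ has a unique strong solution $X$ in $\Delta_d$ on $[0,T]$. Let $p\ge1$ and suppose that, with $\hat p=3p\ (\ge 3)$, there exists a constant $0<\hat C<\infty$ such that $$\sup_{t\in[0,T]}\mathbb{E}[|X(t)|^{\hat p}]+\max_{1\le i<d}\ \sup_{t\in[0,T]}\mathbb{E}\big[|X_i(t)-X_{i+1}(t)|^{-\hat p}\big]<\hat C$$ and $$\mathbb{E}[|X(t)-X(s)|^{\hat p}]\le\hat C|t-s|^{\hat p/2}\quad\text{for all }0\le s<t\le T.$$ Let $X^{(n)}$ be the semi-implicit Euler-Maruyama scheme defined in the context. Then there exists a constant $C>0$, which depends on $d$ (and not on $n$), such that for any $n\in\mathbb{N}$, $$\mathbb{E}\Big[\sup_{k=1,\dots,n}\big|X(t_k^{(n)})-X^{(n)}(t_k^{(n)})\big|^p\Big]^{1/p}\le\frac{C}{n^{1/2}}.$$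
   Context: Let $d\ge 2$, $T>0$, $\Delta_d=\{(x_1,\dots,x_d)^*\in\mathbb{R}^d: x_1<x_2<\cdots<x_d\}$, and let $|\cdot|$ be the Euclidean norm. $W=(W_1,\dots,W_d)^*$ is a $d$-dimensional standard Brownian motion on a probability space $(\Omega,\mathcal F,\mathbb P)$ with a filtration $(\mathcal F_t)_{t\ge0}$ satisfying the usual conditions. Standing assumptions: (A1) $X(0)\in\Delta_d$ almost surely; (A2) $\gamma_{i,j}=\gamma_{j,i}\ge0$ are constants for $i\ne j$, with $\gamma_{i,i+1}>0$ for $i=1,\dots,d-1$; (A3) the functions $b_i:\mathbb{R}^d\to\mathbb{R}$ are globally Lipschitz continuous; (A4) the functions $\sigma_{i,j}:\mathbb{R}^d\to\mathbb{R}$ are globally Lipschitz continuous and bounded. Semi-implicit Euler-Maruyama scheme: for $n\in\mathbb{N}$ put $t_k^{(n)}=kT/n$ and $X^{(n)}(0)=X(0)$; for $k=0,\dots,n-1$, $X^{(n)}(t_{k+1}^{(n)})$ is the unique solution in $\Delta_d$ of the system ($i=1,\dots,d$) $$X_i^{(n)}(t_{k+1}^{(n)})=X_i^{(n)}(t_k^{(n)})+\Big\{\sum_{j\ne i}\frac{\gamma_{i,j}}{X_i^{(n)}(t_{k+1}^{(n)})-X_j^{(n)}(t_{k+1}^{(n)})}+b_i\big(X^{(n)}(t_k^{(n)})\big)\Big\}\frac Tn+\sum_{j=1}^d\sigma_{i,j}\big(X^{(n)}(t_k^{(n)})\big)\big\{W_j(t_{k+1}^{(n)})-W_j(t_k^{(n)})\big\}.$$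 (It is known that this system has exactly one solution in $\Delta_d$.) *)

theory Defs
  imports "HOL-Probability.Probability"
begin

text \<open>
  Vectors in d dimensions are elements of \<open>real ^ 'n\<close> with \<open>CARD('n) = d\<close>. The order of the
  coordinates is a linear order on the finite index type \<open>'n\<close> (e.g. a numeral type), so that
  the indices i and i+1 become an index and its immediate successor.
\<close>

definition consecutive :: "'n::linorder \<Rightarrow> 'n \<Rightarrow> bool" where
  "consecutive i j \<longleftrightarrow> i < j \<and> \<not> (\<exists>k. i < k \<and> k < j)"

definition ordered_chamber :: "(real ^ 'n::{finite,linorder}) set" where
  "ordered_chamber = {x. \<forall>i j. i < j \<longrightarrow> x $ i < x $ j}"

definition usual_conditions :: "'a measure \<Rightarrow> (real \<Rightarrow> 'a measure) \<Rightarrow> bool" where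
  "usual_conditions M F \<longleftrightarrow>
     complete_measure M \<and>
     (\<forall>t\<ge>0. subalgebra M (F t)) \<and>
     (\<forall>s t. 0 \<le> s \<and> s \<le> t \<longrightarrow> sets (F s) \<subseteq> sets (F t)) \<and>
     null_sets M \<subseteq> sets (F 0) \<and>
     (\<forall>t\<ge>0. sets (F t) = (\<Inter>s\<in>{t<..}. sets (F s)))"

text \<open>
  Standard Brownian motion with respect to the filtration \<open>F\<close>: the increment over \<open>[s, t]\<close> is
  independent of \<open>F s\<close> and its coordinates are independent and normal with variance \<open>t - s\<close>
  (\<open>normal_density\<close> takes the standard deviation as its second argument).
\<close>

definition standard_brownian_motion ::
  "'a measure \<Rightarrow> (real \<Rightarrow> 'a measure) \<Rightarrow> (real \<Rightarrow> 'a \<Rightarrow> real ^ 'n::finite) \<Rightarrow> bool" where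
  "standard_brownian_motion M F W \<longleftrightarrow>
     (\<forall>t\<ge>0. W t \<in> borel_measurable (F t)) \<and>
     (AE \<omega> in M. W 0 \<omega> = 0) \<and>
     (AE \<omega> in M. continuous_on {0..} (\<lambda>t. W t \<omega>)) \<and>
     (\<forall>s t. 0 \<le> s \<and> s < t \<longrightarrow>
        prob_space.indep_set M (sets (F s))
          {(\<lambda>\<omega>. W t \<omega> - W s \<omega>) -` A \<inter> space M | A. A \<in> sets borel} \<and>
        prob_space.indep_vars M (\<lambda>_. borel) (\<lambda>i \<omega>. W t \<omega> $ i - W s \<omega> $ i) UNIV \<and>
        (\<forall>i. distributed M lborel (\<lambda>\<omega>. W t \<omega> $ i - W s \<omega> $ i)
               (normal_density 0 (sqrt (t - s)))))"

definition repulsion :: "('n \<Rightarrow> 'n \<Rightarrow> real) \<Rightarrow> 'n \<Rightarrow> real ^ 'n::finite \<Rightarrow> real" where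
  "repulsion \<gamma> i x = (\<Sum>j\<in>UNIV - {i}. \<gamma> i j / (x $ i - x $ j))"

text \<open>
  The diffusion matrix \<open>\<sigma>\<close> is constant, so the stochastic integral of \<open>\<sigma> i j\<close> against \<open>W\<^sub>j\<close>
  over \<open>[0, t]\<close> is \<open>\<sigma> i j * (W\<^sub>j t - W\<^sub>j 0)\<close>. The solution lives on the given probability
  space, is adapted to the given filtration and is driven by the given Brownian motion.
\<close>

definition strong_solution ::
  "'a measure \<Rightarrow> (real \<Rightarrow> 'a measure) \<Rightarrow> (real \<Rightarrow> 'a \<Rightarrow> real ^ 'n::{finite,linorder}) \<Rightarrow> real \<Rightarrow>
   ('n \<Rightarrow> 'n \<Rightarrow> real) \<Rightarrow> ('n \<Rightarrow> real ^ 'n::{finite,linorder} \<Rightarrow> real) \<Rightarrow> ('n \<Rightarrow> 'n \<Rightarrow> real) \<Rightarrow>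
   (real \<Rightarrow> 'a \<Rightarrow> real ^ 'n::{finite,linorder}) \<Rightarrow> bool" where
  "strong_solution M F W T \<gamma> b \<sigma> X \<longleftrightarrow>
     (\<forall>t\<in>{0..T}. X t \<in> borel_measurable (F t)) \<and>
     (AE \<omega> in M. continuous_on {0..T} (\<lambda>t. X t \<omega>)) \<and>
     (AE \<omega> in M. \<forall>t\<in>{0..T}. X t \<omega> \<in> ordered_chamber) \<and>
     (AE \<omega> in M. \<forall>i. \<forall>t\<in>{0..T}.
        set_integrable lborel {0..t} (\<lambda>s. repulsion \<gamma> i (X s \<omega>) + b i (X s \<omega>)) \<and>
        X t \<omega> $ i = X 0 \<omega> $ i
          + (LINT s:{0..t}|lborel. repulsion \<gamma> i (X s \<omega>) + b i (X s \<omega>))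
          + (\<Sum>j\<in>UNIV. \<sigma> i j * (W t \<omega> $ j - W 0 \<omega> $ j)))"

definition unique_strong_solution ::
  "'a measure \<Rightarrow> (real \<Rightarrow> 'a measure) \<Rightarrow> (real \<Rightarrow> 'a \<Rightarrow> real ^ 'n::{finite,linorder}) \<Rightarrow> real \<Rightarrow>
   ('n \<Rightarrow> 'n \<Rightarrow> real) \<Rightarrow> ('n \<Rightarrow> real ^ 'n::{finite,linorder} \<Rightarrow> real) \<Rightarrow> ('n \<Rightarrow> 'n \<Rightarrow> real) \<Rightarrow>
   (real \<Rightarrow> 'a \<Rightarrow> real ^ 'n::{finite,linorder}) \<Rightarrow> bool" where
  "unique_strong_solution M F W T \<gamma> b \<sigma> X \<longleftrightarrow>
     strong_solution M F W T \<gamma> b \<sigma> X \<and>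
     (\<forall>Y. strong_solution M F W T \<gamma> b \<sigma> Y \<and> (AE \<omega> in M. Y 0 \<omega> = X 0 \<omega>) \<longrightarrow>
        (AE \<omega> in M. \<forall>t\<in>{0..T}. Y t \<omega> = X t \<omega>))"

definition grid :: "real \<Rightarrow> nat \<Rightarrow> nat \<Rightarrow> real" where
  "grid T n k = real k * T / real n"

text \<open>
  One step of the scheme from \<open>x\<close>, with step size \<open>h\<close> and Brownian increment \<open>w\<close>. For
  \<open>h > 0\<close> the system has exactly one solution in the chamber for every \<open>x\<close>, also outside the
  chamber, so the description is always proper.
\<close>

definition semi_implicit_EM_step ::
  "('n \<Rightarrow> 'n \<Rightarrow> real) \<Rightarrow> ('n \<Rightarrow> real ^ 'n::{finite,linorder} \<Rightarrow> real) \<Rightarrow> ('n \<Rightarrow> 'n \<Rightarrow> real ^ 'n::{finite,linorder} \<Rightarrow> real) \<Rightarrow>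
   real \<Rightarrow> real ^ 'n::{finite,linorder} \<Rightarrow> real ^ 'n::{finite,linorder} \<Rightarrow> real ^ 'n::{finite,linorder}" where
  "semi_implicit_EM_step \<gamma> b \<sigma> h x w =
     (THE y. y \<in> ordered_chamber \<and>
        (\<forall>i. y $ i = x $ i + (repulsion \<gamma> i y + b i x) * h + (\<Sum>j\<in>UNIV. \<sigma> i j x * w $ j)))"

primrec semi_implicit_EM ::
  "('n \<Rightarrow> 'n \<Rightarrow> real) \<Rightarrow> ('n \<Rightarrow> real ^ 'n::{finite,linorder} \<Rightarrow> real) \<Rightarrow> ('n \<Rightarrow> 'n \<Rightarrow> real ^ 'n::{finite,linorder} \<Rightarrow> real) \<Rightarrow>
   real \<Rightarrow> (real \<Rightarrow> 'a \<Rightarrow> real ^ 'n::{finite,linorder}) \<Rightarrow> ('a \<Rightarrow> real ^ 'n::{finite,linorder}) \<Rightarrow> nat \<Rightarrow> nat \<Rightarrow> 'a \<Rightarrow>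
   real ^ 'n::{finite,linorder}" where
  "semi_implicit_EM \<gamma> b \<sigma> T W \<xi> n 0 = \<xi>"
| "semi_implicit_EM \<gamma> b \<sigma> T W \<xi> n (Suc k) =
     (\<lambda>\<omega>. semi_implicit_EM_step \<gamma> b \<sigma> (T / real n) (semi_implicit_EM \<gamma> b \<sigma> T W \<xi> n k \<omega>)
        (W (grid T n (Suc k)) \<omega> - W (grid T n k) \<omega>))"

text \<open>
  Moments are formed in \<open>ennreal\<close>, so that no integrability is presupposed. In the negative
  moments the convention \<open>0 powr q = 0\<close> plays no role: consecutive coordinates of a solution
  are almost surely distinct. The outer supremum is over finitely many (and, in dimension at
  least two, some) pairs of consecutive indices, i.e. a maximum.
\<close>

definition moment_sum ::
  "'a measure \<Rightarrow> real \<Rightarrow> real \<Rightarrow> (real \<Rightarrow> 'a \<Rightarrow> real ^ 'n::{finite,linorder}) \<Rightarrow> ennreal" where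
  "moment_sum M T q X =
     (SUP t\<in>{0..T}. \<integral>\<^sup>+\<omega>. ennreal (norm (X t \<omega>) powr q) \<partial>M) +
     (SUP (i, j)\<in>{(i, j). consecutive i j}.
        SUP t\<in>{0..T}. \<integral>\<^sup>+\<omega>. ennreal (\<bar>X t \<omega> $ i - X t \<omega> $ j\<bar> powr (- q)) \<partial>M)"

end

theory Submission
  imports Defs
begin

text \<open>
  The repulsive part of the drift, evaluated at the new point of the implicit step, is a monotone
  (dissipative) map on the ordered chamber: \<open>(drift x - drift y) \<bullet> (x - y) \<le> 0\<close>, because pairs of
  coordinates are ordered in the same way in both points and \<open>u \<mapsto> 1 / u\<close> decreases on each half line
  (\<open>drift_monotone\<close>). Hence one implicit step is a contraction of its explicit data
  (\<open>implicit_step_stable\<close>). The singularity of the drift therefore never enters the propagation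
  of errors; only the Lipschitz part \<open>b\<close> does, through a Gronwall factor.

  As the noise is additive, the exact solution satisfies the recursion of the scheme up to a
  residual that contains no stochastic integral: it is the time integral, over one step, of the
  oscillation of \<open>repulsion + b\<close> along the path. The global error at every grid point is thus bounded,
  path by path, by a constant times the sum of the norms of all residuals
  (\<open>EM_error_le_residuals\<close>). This bound does not depend on the grid point, so it holds for the
  supremum over the grid as well.

  The residual is small by the moment hypotheses. From
  \<open>1 / u - 1 / v = (v - u) / (u * v)\<close> the oscillation of the repulsion is bounded by the increment of the
  path times the inverse gaps at the two times (\<open>repulsion_diff_le\<close>). This is a product of three
  factors, which is why moments of order \<open>3 * p\<close> control its moment of order \<open>p\<close>; the increment contributes
  \<open>h powr (1 / 2)\<close> in the \<open>p\<close>-norm. After integration over a step of length \<open>h\<close> the residual is of size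
  \<open>h powr (3 / 2)\<close> (\<open>residual_moment\<close>), and the \<open>n\<close> residuals add up to order \<open>n powr (- 1 / 2)\<close>.

  Two things remain. The scheme is well defined because one step is the minimizer of a
  coercive energy, a quadratic term plus logarithmic barriers (\<open>implicit_step_exists\<close>); and it is measurable
  because the step depends continuously on its data. The exchange of the time integral with
  the expectation uses a jointly measurable version of the solution
  (\<open>jointly_measurable_version\<close>).
\<close>

section \<open>Power inequalities and a discrete Gronwall bound\<close>

text \<open>
  Optimizing over \<open>\<epsilon>\<close> turns a family of affine bounds into a power bound. Together with the next lemma
  it gives Jensen's inequality, up to the factor \<open>2 powr p\<close>, for integrals and for sums alike.
\<close>

lemma powr_le_of_affine_bounds:
  fixes S m G p :: real
  assumes "S \<ge> 0" "m > 0" "G \<ge> 0" "p \<ge> 1"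
    and bound: "\<And>\<epsilon>. \<epsilon> > 0 \<Longrightarrow> S \<le> \<epsilon> * m + \<epsilon> powr (1 - p) * G"
  shows "S powr p \<le> 2 powr p * m powr (p - 1) * G"
proof (cases "G = 0")
  case True
  \<comment> \<open>Here no choice of \<open>\<epsilon>\<close> is optimal, but the bound tends to zero with \<open>\<epsilon>\<close>.\<close>
  have "S \<le> 0 + e" if "e > 0" for e
    using bound[of "e / m"] that True assms(2) by simp
  then have "S \<le> 0" by (rule field_le_epsilon)
  then show ?thesis using assms True by simp
next
  case False
  \<comment> \<open>The choice that makes both terms of the affine bound equal.\<close>
  define \<epsilon> where "\<epsilon> = (G / m) powr (1 / p)"
  have G: "G > 0" using False assms by simp
  then have e: "\<epsilon> > 0" "\<epsilon> powr p = G / m"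
    using assms by (auto simp: \<epsilon>_def powr_powr)
  have "\<epsilon> powr (1 - p) * G = \<epsilon> * m"
    using e G assms by (simp add: powr_diff)
  then have "S \<le> 2 * \<epsilon> * m" using bound[OF e(1)] by simp
  then have "S powr p \<le> (2 * \<epsilon> * m) powr p"
    using assms by (intro powr_mono2) auto
  also have "\<dots> = 2 powr p * (G / m) * m powr p"
    using e assms by (simp add: powr_mult)
  also have "\<dots> = 2 powr p * m powr (p - 1) * G"
    using assms by (simp add: powr_diff)
  finally show ?thesis .
qed

text \<open>
  Either \<open>x \<le> \<epsilon>\<close>, or \<open>x / \<epsilon> \<ge> 1\<close> and raising it to the power \<open>p \<ge> 1\<close> only increases it.
\<close>

lemma le_affine_powr:
  fixes x \<epsilon> p :: real
  assumes "x \<ge> 0" "\<epsilon> > 0" "p \<ge> 1"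
  shows "x \<le> \<epsilon> + \<epsilon> powr (1 - p) * x powr p"
proof (cases "x \<le> \<epsilon>")
  case True
  then show ?thesis using assms by (simp add: add_increasing2)
next
  case False
  then have "\<epsilon> powr (p - 1) \<le> x powr (p - 1)" using assms by (intro powr_mono2) auto
  then have "\<epsilon> powr (1 - p) * x powr (p - 1) \<ge> \<epsilon> powr (1 - p) * \<epsilon> powr (p - 1)"
    by (intro mult_left_mono) auto
  then have "1 \<le> \<epsilon> powr (1 - p) * x powr (p - 1)"
    using assms by (simp add: powr_add[symmetric])
  then have "x * 1 \<le> x * (\<epsilon> powr (1 - p) * x powr (p - 1))"
    using assms by (intro mult_left_mono) auto
  also have "\<dots> = \<epsilon> powr (1 - p) * x powr p"
    using assms False by (simp add: powr_diff)
  finally show ?thesis using assms by simp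
qed

text \<open>
  The left-hand side is stated for a real \<open>S\<close> below the integral, so that the lemma applies to
  the norm of a residual and both integrals may be infinite.
\<close>

lemma nn_integral_powr_Jensen:
  fixes g :: "'b \<Rightarrow> real"
  assumes g[measurable]: "g \<in> borel_measurable N" and g0: "\<And>x. g x \<ge> 0"
    and m: "emeasure N (space N) = ennreal m" "m > 0" and p: "p \<ge> 1"
    and S: "S \<ge> 0" "ennreal S \<le> (\<integral>\<^sup>+x. ennreal (g x) \<partial>N)"
  shows "ennreal (S powr p) \<le> ennreal (2 powr p * m powr (p - 1)) * (\<integral>\<^sup>+x. ennreal (g x powr p) \<partial>N)"
proof (cases "\<integral>\<^sup>+x. ennreal (g x powr p) \<partial>N" rule: ennreal_cases)
  case (real G)
  have "S \<le> \<epsilon> * m + \<epsilon> powr (1 - p) * G" if "\<epsilon> > 0" for \<epsilon>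
  proof -
    have "ennreal S \<le> (\<integral>\<^sup>+x. ennreal \<epsilon> + ennreal (\<epsilon> powr (1 - p)) * ennreal (g x powr p) \<partial>N)"
      using le_affine_powr[OF g0 that p] that
      by (intro order.trans[OF S(2)] nn_integral_mono)
        (auto simp: ennreal_mult'[symmetric] ennreal_plus[symmetric] simp del: ennreal_plus)
    also have "\<dots> = ennreal \<epsilon> * ennreal m + ennreal (\<epsilon> powr (1 - p)) * ennreal G"
      by (simp add: nn_integral_add nn_integral_cmult m real)
    also have "\<dots> = ennreal (\<epsilon> * m + \<epsilon> powr (1 - p) * G)"
      using that m real by (simp add: ennreal_mult'[symmetric] ennreal_plus[symmetric] del: ennreal_plus)
    finally show ?thesis using that m real by (subst (asm) ennreal_le_iff) auto
  qed
  from powr_le_of_affine_bounds[OF S(1) m(2) _ p this]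
  show ?thesis using real by (simp add: ennreal_mult'[symmetric])
next
  case top
  then show ?thesis using m p by (simp add: ennreal_mult_top)
qed

lemma sum_powr_le:
  fixes a :: "'b \<Rightarrow> real"
  assumes "finite I" "I \<noteq> {}" "\<And>i. i \<in> I \<Longrightarrow> a i \<ge> 0" "p \<ge> 1"
  shows "(\<Sum>i\<in>I. a i) powr p \<le> 2 powr p * real (card I) powr (p - 1) * (\<Sum>i\<in>I. a i powr p)"
proof (rule powr_le_of_affine_bounds)
  fix \<epsilon> :: real assume "\<epsilon> > 0"
  then have "(\<Sum>i\<in>I. a i) \<le> (\<Sum>i\<in>I. \<epsilon> + \<epsilon> powr (1 - p) * a i powr p)"
    using assms by (intro sum_mono le_affine_powr) auto
  also have "\<dots> = \<epsilon> * real (card I) + \<epsilon> powr (1 - p) * (\<Sum>i\<in>I. a i powr p)"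
    by (simp add: sum.distrib sum_distrib_left)
  finally show "(\<Sum>i\<in>I. a i) \<le> \<epsilon> * real (card I) + \<epsilon> powr (1 - p) * (\<Sum>i\<in>I. a i powr p)" .
qed (use assms in \<open>auto intro!: sum_nonneg simp: card_gt_0_iff\<close>)

lemma add_powr_le:
  fixes u v p :: real
  assumes "u \<ge> 0" "v \<ge> 0" "p \<ge> 1"
  shows "(u + v) powr p \<le> 2 powr p * 2 powr (p - 1) * (u powr p + v powr p)"
  using sum_powr_le[of "{False, True}" "\<lambda>b. if b then u else v" p] assms
  by (simp add: add.commute)

text \<open>
  Hoelder's inequality with exponents \<open>3, 3, 3\<close> in pointwise form, from
  \<open>x * y * z \<le> x ^ 3 + y ^ 3 + z ^ 3\<close>. The weight \<open>h powr (p / 2)\<close> is the expected size of \<open>a powr p\<close>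
  when \<open>a\<close> is an increment over time \<open>h\<close>; normalizing by it first is what keeps the order in \<open>h\<close>.
\<close>

lemma mult3_powr_le:
  fixes a b c h p :: real
  assumes "a \<ge> 0" "b \<ge> 0" "c \<ge> 0" "h > 0"
  shows "(a * b * c) powr p
    \<le> h powr (p / 2) * (a powr (3 * p) / h powr (3 * p / 2) + b powr (3 * p) + c powr (3 * p))"
proof -
  have cube: "x powr (3 * p) = (x powr p) ^ 3" for x :: real
    by (simp add: powr_powr[symmetric] powr_numeral mult.commute flip: powr_powr)
  have hcube: "h powr (3 * p / 2) = (h powr (p / 2)) ^ 3"
    using cube[of "h powr (1/2)"] assms by (simp add: powr_powr)
  have amgm: "x * y * z \<le> x ^ 3 + y ^ 3 + z ^ 3" if "x \<ge> 0" "y \<ge> 0" "z \<ge> 0" for x y z :: real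
  proof -
    define m where "m = max x (max y z)"
    have "x * y * z \<le> m * m * m"
      using that by (intro mult_mono) (auto simp: m_def)
    also have "m * m * m = m ^ 3" by (simp add: power3_eq_cube)
    also have "\<dots> \<le> x ^ 3 + y ^ 3 + z ^ 3" unfolding m_def max_def using that by auto
    finally show ?thesis .
  qed
  define k where "k = h powr (p / 2)"
  have k: "k > 0" using assms by (simp add: k_def)
  have "(a * b * c) powr p = k * (a powr p / k * b powr p * c powr p)"
    using assms k by (simp add: powr_mult)
  also have "\<dots> \<le> k * ((a powr p / k) ^ 3 + (b powr p) ^ 3 + (c powr p) ^ 3)"
    using assms k by (intro mult_left_mono amgm) auto
  finally show ?thesis
    unfolding cube hcube k_def[symmetric] by (simp add: power_divide)
qed

lemma discrete_Gronwall_sum: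
  fixes e r :: "nat \<Rightarrow> real"
  assumes "e 0 = 0" "c \<ge> 0" "\<And>k. r k \<ge> 0" "\<And>k. k < n \<Longrightarrow> e (Suc k) \<le> (1 + c) * e k + r k" "k \<le> n"
  shows "e k \<le> exp (c * real k) * (\<Sum>j<k. r j)"
  using \<open>k \<le> n\<close>
proof (induction k)
  case (Suc k)
  have "e (Suc k) \<le> (1 + c) * e k + r k" using Suc assms by simp
  also have "\<dots> \<le> exp c * (exp (c * real k) * (\<Sum>j<k. r j)) + exp (c * real (Suc k)) * r k"
  proof (rule add_mono)
    have "(1 + c) * e k \<le> (1 + c) * (exp (c * real k) * (\<Sum>j<k. r j))"
      using Suc assms by (intro mult_left_mono) auto
    also have "\<dots> \<le> exp c * (exp (c * real k) * (\<Sum>j<k. r j))"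
      using assms by (intro mult_right_mono exp_ge_add_one_self mult_nonneg_nonneg sum_nonneg) auto
    finally show "(1 + c) * e k \<le> exp c * (exp (c * real k) * (\<Sum>j<k. r j))" .
    have "1 * r k \<le> exp (c * real (Suc k)) * r k"
      using assms by (intro mult_right_mono) auto
    then show "r k \<le> exp (c * real (Suc k)) * r k" by simp
  qed
  also have "\<dots> = exp (c * real (Suc k)) * (\<Sum>j<Suc k. r j)"
    by (simp add: algebra_simps exp_add)
  finally show ?case .
qed (use assms in simp)

section \<open>Measurability in time and randomness jointly\<close>

lemma borel_measurable_vec:
  fixes f :: "'a \<Rightarrow> real ^ 'n::finite"
  assumes "\<And>i. (\<lambda>x. f x $ i) \<in> borel_measurable M"
  shows "f \<in> borel_measurable M"
  using assms by (subst borel_measurable_euclidean_space) (auto simp: Basis_vec_def inner_axis)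

text \<open>
  Freezing the time at the grid points \<open>i / (m + 1)\<close> gives countably many pieces, hence a jointly measurable
  process; by continuity these processes converge to \<open>Y\<close> as \<open>m\<close> grows.
\<close>

lemma jointly_measurable_of_continuous_paths:
  fixes Y :: "real \<Rightarrow> 'a \<Rightarrow> 'b::{metric_space}"
  assumes Y: "\<And>t. Y t \<in> borel_measurable M"
    and cont: "\<And>\<omega>. \<omega> \<in> space M \<Longrightarrow> continuous_on UNIV (\<lambda>t. Y t \<omega>)"
  shows "(\<lambda>(t, \<omega>). Y t \<omega>) \<in> borel_measurable (borel \<Otimes>\<^sub>M M)"
proof (rule borel_measurable_LIMSEQ_metric)
  show "(\<lambda>z. Y (real_of_int \<lfloor>real (Suc m) * fst z\<rfloor> / real (Suc m)) (snd z))
      \<in> borel_measurable (borel \<Otimes>\<^sub>M M)" for m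
  proof (rule measurable_compose_countable[where f = "\<lambda>i z. Y (real_of_int i / real (Suc m)) (snd z)"])
    show "(\<lambda>z. Y (real_of_int i / real (Suc m)) (snd z)) \<in> borel_measurable (borel \<Otimes>\<^sub>M M)" for i
      using Y by (rule measurable_compose[OF measurable_snd])
    show "(\<lambda>z. \<lfloor>real (Suc m) * fst z\<rfloor>) \<in> borel \<Otimes>\<^sub>M M \<rightarrow>\<^sub>M count_space UNIV"
      by measurable
  qed
  fix z :: "real \<times> 'a" assume "z \<in> space (borel \<Otimes>\<^sub>M M)"
  then have "snd z \<in> space M" by (auto simp: space_pair_measure)
  define t where "t = fst z"
  have "(\<lambda>m. real_of_int \<lfloor>real (Suc m) * t\<rfloor> / real (Suc m)) \<longlonglongrightarrow> t"
  proof (rule tendsto_sandwich[of "\<lambda>m. t - 1 / real (Suc m)" _ _ "\<lambda>m. t"])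
    show "\<forall>\<^sub>F m in sequentially. t - 1 / real (Suc m) \<le> real_of_int \<lfloor>real (Suc m) * t\<rfloor> / real (Suc m)"
    proof (intro always_eventually allI)
      fix m
      have "real (Suc m) * t - 1 \<le> real_of_int \<lfloor>real (Suc m) * t\<rfloor>" by linarith
      then have "(real (Suc m) * t - 1) / real (Suc m) \<le> real_of_int \<lfloor>real (Suc m) * t\<rfloor> / real (Suc m)"
        by (rule divide_right_mono) simp
      then show "t - 1 / real (Suc m) \<le> real_of_int \<lfloor>real (Suc m) * t\<rfloor> / real (Suc m)"
        by (simp add: diff_divide_distrib del: of_nat_Suc)
    qed
    show "\<forall>\<^sub>F m in sequentially. real_of_int \<lfloor>real (Suc m) * t\<rfloor> / real (Suc m) \<le> t"
      by (intro always_eventually allI) (simp add: divide_le_eq mult.commute del: of_nat_Suc)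
    have "(\<lambda>m. t - 1 / real (Suc m)) \<longlonglongrightarrow> t - 0"
      using LIMSEQ_inverse_real_of_nat by (intro tendsto_diff tendsto_const) (simp add: inverse_eq_divide)
    then show "(\<lambda>m. t - 1 / real (Suc m)) \<longlonglongrightarrow> t" by simp
  qed simp
  moreover have "isCont (\<lambda>t. Y t (snd z)) t"
    using cont[OF \<open>snd z \<in> space M\<close>] by (simp add: continuous_on_eq_continuous_at)
  ultimately have "(\<lambda>m. Y (real_of_int \<lfloor>real (Suc m) * t\<rfloor> / real (Suc m)) (snd z)) \<longlonglongrightarrow> Y t (snd z)"
    by (rule isCont_tendsto_compose[rotated])
  then show "(\<lambda>m. Y (real_of_int \<lfloor>real (Suc m) * fst z\<rfloor> / real (Suc m)) (snd z))
      \<longlonglongrightarrow> (case z of (t, \<omega>) \<Rightarrow> Y t \<omega>)"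
    by (simp add: t_def split_beta)
qed

text \<open>
  The paths are modified on a measurable null set that contains all discontinuous ones, and
  extended from \<open>{0..T}\<close> to the real line by constants.
\<close>

lemma jointly_measurable_version:
  fixes X :: "real \<Rightarrow> 'a \<Rightarrow> 'b::{metric_space}"
  assumes T: "T \<ge> 0"
    and X: "\<And>t. t \<in> {0..T} \<Longrightarrow> X t \<in> borel_measurable M"
    and cont: "AE \<omega> in M. continuous_on {0..T} (\<lambda>t. X t \<omega>)"
  obtains Y where "(\<lambda>(t, \<omega>). Y t \<omega>) \<in> borel_measurable (borel \<Otimes>\<^sub>M M)"
    and "AE \<omega> in M. \<forall>t\<in>{0..T}. Y t \<omega> = X t \<omega>"
proof -
  from cont obtain N where N: "{\<omega> \<in> space M. \<not> continuous_on {0..T} (\<lambda>t. X t \<omega>)} \<subseteq> N"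
    "emeasure M N = 0" "N \<in> sets M" by (rule AE_E)
  define Y where "Y t \<omega> = (if \<omega> \<in> N then undefined else X (max 0 (min T t)) \<omega>)" for t \<omega>
  show ?thesis
  proof
    have clamp: "max 0 (min T t) \<in> {0..T}" for t using T by auto
    show "(\<lambda>(t, \<omega>). Y t \<omega>) \<in> borel_measurable (borel \<Otimes>\<^sub>M M)"
    proof (rule jointly_measurable_of_continuous_paths)
      show "Y t \<in> borel_measurable M" for t
        unfolding Y_def using X[OF clamp] N(3) by (intro measurable_If_set) auto
      fix \<omega> assume "\<omega> \<in> space M"
      show "continuous_on UNIV (\<lambda>t. Y t \<omega>)"
      proof (cases "\<omega> \<in> N")
        case False
        then have "continuous_on {0..T} (\<lambda>t. X t \<omega>)" using N(1) \<open>\<omega> \<in> space M\<close> by auto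
        then show ?thesis unfolding Y_def using False clamp
          by (auto intro!: continuous_on_compose2[of "{0..T}" "\<lambda>t. X t \<omega>"] continuous_intros)
      qed (simp add: Y_def)
    qed
    have "AE \<omega> in M. \<omega> \<notin> N" using N by (intro AE_not_in) (auto simp: null_sets_def)
    then show "AE \<omega> in M. \<forall>t\<in>{0..T}. Y t \<omega> = X t \<omega>"
      by eventually_elim (auto simp: Y_def)
  qed
qed

section \<open>The ordered chamber\<close>

lemma consecutive_Min:
  fixes i j :: "'n::{finite,linorder}"
  assumes "i < j"
  obtains k where "consecutive i k" "k \<le> j"
proof
  have fin: "finite {k. i < k}" "{k. i < k} \<noteq> {}" using assms by auto
  then have "i < Min {k. i < k}" using Min_in by blast
  moreover have "\<not> k < Min {k. i < k}" if "i < k" for k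
    using Min_le[of "{k. i < k}" k] that by (simp add: not_less del: Min_le)
  ultimately show "consecutive i (Min {k. i < k})"
    unfolding consecutive_def by blast
  show "Min {k. i < k} \<le> j" using assms by simp
qed

text \<open>
  Every gap in the chamber is at least a gap between neighbours. This reduces bounds for all pairs
  of coordinates to the consecutive pairs, the ones whose coupling is positive and whose
  inverse moments are controlled.
\<close>

lemma chamber_gap:
  assumes "x \<in> ordered_chamber" "i < j" 
  obtains k where "consecutive i k" "0 < x $ k - x $ i" "x $ k - x $ i \<le> x $ j - x $ i"
proof -
  obtain k where k: "consecutive i k" "k \<le> j" using consecutive_Min[OF assms(2)] .
  show ?thesis
  proof
    show "consecutive i k" by fact
    show "0 < x $ k - x $ i" using k assms by (simp add: consecutive_def ordered_chamber_def)
    show "x $ k - x $ i \<le> x $ j - x $ i"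
      using k(2) assms(1) by (cases "k = j") (auto simp: ordered_chamber_def less_le)
  qed
qed

lemma chamber_nonempty: "\<exists>x::real ^ 'n::{finite,linorder}. x \<in> ordered_chamber"
proof
  show "(\<chi> i. real (card {k. k < i})) \<in> (ordered_chamber :: (real ^ 'n::{finite,linorder}) set)"
    unfolding ordered_chamber_def by (auto intro!: psubset_card_mono)
qed

lemma open_chamber: "open (ordered_chamber :: (real ^ 'n::{finite,linorder}) set)"
proof -
  have "ordered_chamber = (\<Inter>i. \<Inter>j\<in>{j. i < j}. {x::real ^ 'n::{finite,linorder}. x $ i < x $ j})"
    unfolding ordered_chamber_def by auto
  moreover have "open \<dots>"
    by (intro open_INT finite_UNIV ballI open_Collect_less continuous_intros) auto
  ultimately show ?thesis by simp
qed

text \<open>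
  A single quantity that dominates \<open>1 / \<bar>x $ i - x $ j\<bar>\<close> for all pairs and whose moments follow
  from those of the consecutive gaps.
\<close>

definition inverse_gaps :: "real ^ 'n::{finite,linorder} \<Rightarrow> real" where
  "inverse_gaps x = (\<Sum>(i, j)\<in>{(i, j). consecutive i j}. 1 / \<bar>x $ i - x $ j\<bar>)"

lemma inverse_gaps_nonneg: "inverse_gaps x \<ge> 0"
  unfolding inverse_gaps_def by (intro sum_nonneg) auto

lemma borel_measurable_inverse_gaps[measurable]: "inverse_gaps \<in> borel_measurable borel"
  unfolding inverse_gaps_def split_beta by measurable

lemma inverse_gap_le:
  assumes x: "x \<in> ordered_chamber" and "i \<noteq> j"
  shows "1 / \<bar>x $ i - x $ j\<bar> \<le> inverse_gaps x"
proof -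
  have *: "1 / \<bar>x $ i - x $ j\<bar> \<le> inverse_gaps x" if ij: "i < j" for i j
  proof -
    obtain k where k: "consecutive i k" "0 < x $ k - x $ i" "x $ k - x $ i \<le> x $ j - x $ i"
      using chamber_gap[OF x ij] .
    then have "1 / \<bar>x $ i - x $ j\<bar> \<le> 1 / \<bar>x $ i - x $ k\<bar>"
      by (intro divide_left_mono) auto
    also have "\<dots> \<le> inverse_gaps x"
      unfolding inverse_gaps_def
      using member_le_sum[of "(i, k)" "{(i, j). consecutive i j}" "\<lambda>(i, j). 1 / \<bar>x $ i - x $ j\<bar>"] k(1)
      by auto
    finally show ?thesis .
  qed
  show ?thesis
    using *[of i j] *[of j i] \<open>i \<noteq> j\<close> by (cases "i < j") (auto simp: abs_minus_commute)
qed

lemma inverse_gaps_powr_le: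
  fixes x :: "real ^ 'n::{finite,linorder}"
  assumes "q \<ge> 1"
  shows "inverse_gaps x powr q \<le> 2 powr q * real (card {(i::'n, j). consecutive i j}) powr (q - 1) *
    (\<Sum>(i, j)\<in>{(i, j). consecutive i j}. \<bar>x $ i - x $ j :: real\<bar> powr (- q))"
    (is "_ \<le> ?c * _")
proof (cases "{(i::'n, j). consecutive i j} = {}")
  case True
  show ?thesis unfolding inverse_gaps_def True using assms by simp
next
  case False
  have "inverse_gaps x powr q \<le> ?c *
    (\<Sum>z\<in>{(i, j). consecutive i j}. (case z of (i, j) \<Rightarrow> 1 / \<bar>x $ i - x $ j\<bar>) powr q)"
    unfolding inverse_gaps_def using False assms by (intro sum_powr_le) auto
  also have "(\<Sum>z\<in>{(i, j). consecutive i j}. (case z of (i, j) \<Rightarrow> 1 / \<bar>x $ i - x $ j\<bar>) powr q)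
      = (\<Sum>(i, j)\<in>{(i, j). consecutive i j}. \<bar>x $ i - x $ j\<bar> powr (- q))"
    by (intro sum.cong) (auto simp: powr_minus powr_divide inverse_eq_divide)
  finally show ?thesis .
qed

lemma inverse_gaps_moment:
  fixes X :: "real \<Rightarrow> 'a \<Rightarrow> real ^ 'n::{finite,linorder}"
  assumes X: "\<And>t. t \<in> {0..T} \<Longrightarrow> X t \<in> borel_measurable M"
    and mom: "moment_sum M T q X \<le> ennreal c" and "c > 0" "q \<ge> 1"
  shows "\<exists>K. \<forall>t\<in>{0..T}. (\<integral>\<^sup>+\<omega>. ennreal (inverse_gaps (X t \<omega>) powr q) \<partial>M) \<le> ennreal K"
proof -
  define P where "P = {(i::'n, j). consecutive i j}"
  define B where "B = 2 powr q * real (card P) powr (q - 1)"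
  have B0: "B \<ge> 0" unfolding B_def by simp
  show ?thesis
  proof (intro exI ballI)
    fix t assume t: "t \<in> {0..T}"
    note [measurable] = X[OF t]
    have pair: "(\<integral>\<^sup>+\<omega>. ennreal (\<bar>X t \<omega> $ fst z - X t \<omega> $ snd z\<bar> powr (- q)) \<partial>M) \<le> ennreal c" if "z \<in> P" for z
    proof -
      have "(\<integral>\<^sup>+\<omega>. ennreal (\<bar>X t \<omega> $ fst z - X t \<omega> $ snd z\<bar> powr (- q)) \<partial>M)
         \<le> (SUP t\<in>{0..T}. \<integral>\<^sup>+\<omega>. ennreal (\<bar>X t \<omega> $ fst z - X t \<omega> $ snd z\<bar> powr (- q)) \<partial>M)"
        using t by (rule SUP_upper)
      also have "\<dots> \<le> (SUP (i, j)\<in>P. SUP t\<in>{0..T}. \<integral>\<^sup>+\<omega>. ennreal (\<bar>X t \<omega> $ i - X t \<omega> $ j\<bar> powr (- q)) \<partial>M)"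
        using that unfolding split_beta by (rule SUP_upper)
      also have "\<dots> \<le> moment_sum M T q X" unfolding moment_sum_def P_def by simp
      finally show ?thesis using mom by simp
    qed
    have "(\<integral>\<^sup>+\<omega>. ennreal (inverse_gaps (X t \<omega>) powr q) \<partial>M)
      \<le> (\<integral>\<^sup>+\<omega>. ennreal B * (\<Sum>z\<in>P. ennreal (\<bar>X t \<omega> $ fst z - X t \<omega> $ snd z\<bar> powr (- q))) \<partial>M)"
    proof (intro nn_integral_mono)
      fix \<omega>
      have "inverse_gaps (X t \<omega>) powr q \<le> B * (\<Sum>z\<in>P. \<bar>X t \<omega> $ fst z - X t \<omega> $ snd z\<bar> powr (- q))"
        using inverse_gaps_powr_le[OF \<open>q \<ge> 1\<close>, of "X t \<omega>"] by (simp add: B_def P_def split_beta)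
      then have "ennreal (inverse_gaps (X t \<omega>) powr q)
          \<le> ennreal (B * (\<Sum>z\<in>P. \<bar>X t \<omega> $ fst z - X t \<omega> $ snd z\<bar> powr (- q)))"
        by (rule ennreal_leI)
      then show "ennreal (inverse_gaps (X t \<omega>) powr q)
          \<le> ennreal B * (\<Sum>z\<in>P. ennreal (\<bar>X t \<omega> $ fst z - X t \<omega> $ snd z\<bar> powr (- q)))"
        using B0 by (simp add: ennreal_mult' sum_ennreal)
    qed
    also have "\<dots> = ennreal B * (\<Sum>z\<in>P. \<integral>\<^sup>+\<omega>. ennreal (\<bar>X t \<omega> $ fst z - X t \<omega> $ snd z\<bar> powr (- q)) \<partial>M)"
    proof -
      have "(\<integral>\<^sup>+\<omega>. (\<Sum>z\<in>P. ennreal (\<bar>X t \<omega> $ fst z - X t \<omega> $ snd z\<bar> powr (- q))) \<partial>M)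
          = (\<Sum>z\<in>P. \<integral>\<^sup>+\<omega>. ennreal (\<bar>X t \<omega> $ fst z - X t \<omega> $ snd z\<bar> powr (- q)) \<partial>M)"
        by (rule nn_integral_sum) measurable
      moreover have "(\<lambda>\<omega>. \<Sum>z\<in>P. ennreal (\<bar>X t \<omega> $ fst z - X t \<omega> $ snd z\<bar> powr (- q))) \<in> borel_measurable M"
        by measurable
      ultimately show ?thesis by (simp only: nn_integral_cmult)
    qed
    also have "\<dots> \<le> ennreal B * (\<Sum>z\<in>P. ennreal c)"
      by (intro mult_left_mono sum_mono pair) auto
    also have "\<dots> = ennreal (B * (real (card P) * c))"
      using B0 \<open>c > 0\<close> by (simp add: ennreal_mult' ennreal_of_nat_eq_real_of_nat)
    finally show "(\<integral>\<^sup>+\<omega>. ennreal (inverse_gaps (X t \<omega>) powr q) \<partial>M) \<le> ennreal (B * (real (card P) * c))" .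
  qed
qed

section \<open>Monotonicity of the repulsive drift\<close>

text \<open>
  The double sums below range over all pairs of indices, the diagonal included: as
  \<open>x $ i - x $ i = 0\<close>, the value \<open>\<gamma> i i\<close> enters the drift and the energy only with a factor \<open>1 / 0 = 0\<close> or \<open>ln 0 = 0\<close>.
\<close>

locale repulsion_strengths =
  fixes \<gamma> :: "'n::{finite,linorder} \<Rightarrow> 'n \<Rightarrow> real"
  assumes sym: "i \<noteq> j \<Longrightarrow> \<gamma> i j = \<gamma> j i"
    and nonneg: "i \<noteq> j \<Longrightarrow> \<gamma> i j \<ge> 0"
    and pos: "consecutive i j \<Longrightarrow> \<gamma> i j > 0"
begin

definition drift :: "real ^ 'n::{finite,linorder} \<Rightarrow> real ^ 'n::{finite,linorder}" where
  "drift x = (\<chi> i. repulsion \<gamma> i x)"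

lemma drift_nth: "drift x $ i = (\<Sum>j\<in>UNIV. \<gamma> i j / (x $ i - x $ j))"
  unfolding drift_def repulsion_def by (simp add: sum.remove[of UNIV i])

text \<open>
  Summation by parts over pairs: by symmetry of \<open>\<gamma>\<close> the pair forces are antisymmetric, so testing the
  drift against \<open>z\<close> involves only differences of the coordinates of \<open>z\<close>.
\<close>

lemma inner_drift:
  "drift x \<bullet> z = (\<Sum>i\<in>UNIV. \<Sum>j\<in>UNIV. \<gamma> i j * (z $ i - z $ j) / (x $ i - x $ j)) / 2"
proof -
  define S where "S = (\<Sum>i\<in>UNIV. \<Sum>j\<in>UNIV. \<gamma> i j * z $ i / (x $ i - x $ j))"
  have swap: "\<gamma> i j * z $ j / (x $ i - x $ j) = - (\<gamma> j i * z $ j / (x $ j - x $ i))" for i j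
  proof (cases "i = j")
    case False
    have "x $ i - x $ j = - (x $ j - x $ i)" by simp
    then show ?thesis unfolding sym[OF False] by (metis divide_minus_right)
  qed simp
  have "(\<Sum>i\<in>UNIV. \<Sum>j\<in>UNIV. \<gamma> i j * z $ j / (x $ i - x $ j))
      = (\<Sum>j\<in>UNIV. \<Sum>i\<in>UNIV. \<gamma> i j * z $ j / (x $ i - x $ j))"
    by (rule sum.swap)
  also have "\<dots> = (\<Sum>j\<in>UNIV. \<Sum>i\<in>UNIV. - (\<gamma> j i * z $ j / (x $ j - x $ i)))"
    by (intro sum.cong refl swap)
  also have "\<dots> = - S"
    unfolding S_def by (simp add: sum_negf)
  finally have "(\<Sum>i\<in>UNIV. \<Sum>j\<in>UNIV. \<gamma> i j * (z $ i - z $ j) / (x $ i - x $ j)) = 2 * S"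
    by (simp add: right_diff_distrib diff_divide_distrib sum_subtractf S_def)
  moreover have "drift x \<bullet> z = S"
    unfolding inner_vec_def drift_nth S_def by (simp add: sum_distrib_right)
  ultimately show ?thesis by simp
qed

text \<open>
  A pair with difference \<open>u\<close> in \<open>x\<close> and \<open>v\<close> in \<open>y\<close> contributes a nonnegative multiple of
  \<open>(1 / u - 1 / v) * (u - v) = - (u - v)\<^sup>2 / (u * v)\<close>, and \<open>u\<close> and \<open>v\<close> have the same sign in the chamber.
\<close>

lemma drift_monotone:
  assumes "x \<in> ordered_chamber" "y \<in> ordered_chamber"
  shows "(drift x - drift y) \<bullet> (x - y) \<le> 0"
proof -
  have "\<gamma> i j * ((x - y) $ i - (x - y) $ j) / (x $ i - x $ j)
      \<le> \<gamma> i j * ((x - y) $ i - (x - y) $ j) / (y $ i - y $ j)" for i j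
  proof (cases "i = j")
    case False
    define u v where "u = x $ i - x $ j" and "v = y $ i - y $ j"
    have "0 < u * v" 
      using False assms unfolding ordered_chamber_def u_def v_def
      by (cases "i < j") (auto simp: zero_less_mult_iff not_less_iff_gr_or_eq)
    then have uv: "u \<noteq> 0" "v \<noteq> 0" by auto
    have "(u - v) / u - (u - v) / v = - ((u - v)\<^sup>2 / (u * v))"
      using uv by (simp add: field_simps power2_eq_square)
    also have "\<dots> \<le> 0" using \<open>0 < u * v\<close> by simp
    finally have "\<gamma> i j * ((u - v) / u) \<le> \<gamma> i j * ((u - v) / v)"
      using nonneg[OF False] by (intro mult_left_mono) auto
    moreover have "(x - y) $ i - (x - y) $ j = u - v" by (simp add: u_def v_def)
    ultimately show ?thesis by (simp only: u_def[symmetric] v_def[symmetric] times_divide_eq_right)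
  qed simp
  then have "(\<Sum>i\<in>UNIV. \<Sum>j\<in>UNIV. \<gamma> i j * ((x - y) $ i - (x - y) $ j) / (x $ i - x $ j))
      \<le> (\<Sum>i\<in>UNIV. \<Sum>j\<in>UNIV. \<gamma> i j * ((x - y) $ i - (x - y) $ j) / (y $ i - y $ j))"
    by (intro sum_mono)
  then show ?thesis
    unfolding inner_diff_left inner_drift by linarith
qed

text \<open>
  Testing the difference of the two equations against \<open>x - y\<close>, the drift contributes a term of
  nonpositive sign, for every step size.
\<close>

lemma implicit_step_stable:
  assumes "x \<in> ordered_chamber" "y \<in> ordered_chamber" "h \<ge> 0"
    and "x = u + h *\<^sub>R drift x" "y = v + h *\<^sub>R drift y"
  shows "norm (x - y) \<le> norm (u - v)"
proof -
  have "x - y = (u - v) + h *\<^sub>R (drift x - drift y)"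
    by (subst assms(4), subst assms(5)) (simp add: algebra_simps)
  then have "(x - y) \<bullet> (x - y) = (u - v) \<bullet> (x - y) + h * ((drift x - drift y) \<bullet> (x - y))"
    by (metis inner_add_left inner_scaleR_left)
  also have "\<dots> \<le> norm (u - v) * norm (x - y)"
    using drift_monotone[OF assms(1,2)] \<open>h \<ge> 0\<close> norm_cauchy_schwarz[of "u - v" "x - y"]
    by (smt (verit) mult_nonneg_nonpos)
  finally have "norm (x - y) * norm (x - y) \<le> norm (u - v) * norm (x - y)"
    by (simp add: dot_square_norm power2_eq_square)
  then show ?thesis
    by (metis mult_right_le_imp_le norm_ge_zero order_le_less)
qed

end

section \<open>Solvability and stability of the implicit step\<close>

context repulsion_strengths
begin

lemma ln_square_le: "ln ((y $ i - y $ j)\<^sup>2) \<le> 4 * norm (y :: real ^ 'n::{finite,linorder})"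
proof (cases "y $ i = y $ j")
  case False
  define w where "w = \<bar>y $ i - y $ j\<bar>"
  have w: "w > 0" "(y $ i - y $ j)\<^sup>2 = w\<^sup>2" using False by (auto simp: w_def)
  have "ln (w\<^sup>2) = 2 * ln w" using w by (simp add: ln_realpow)
  also have "\<dots> \<le> 2 * w" using ln_bound[OF w(1)] by simp
  also have "w \<le> 2 * norm y"
    using component_le_norm_cart[of y i] component_le_norm_cart[of y j] unfolding w_def by linarith
  finally show ?thesis using w by simp
qed simp

text \<open>
  The potential whose critical points in the chamber are the solutions of \<open>y = a + h *\<^sub>R drift y\<close>. Logarithms of
  squares avoid a case distinction on the order of \<open>i\<close> and \<open>j\<close>; each pair is counted twice and each
  square doubles the logarithm, whence the factor \<open>1 / 4\<close>.
\<close>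

definition energy :: "real \<Rightarrow> real ^ 'n::{finite,linorder} \<Rightarrow> real ^ 'n::{finite,linorder} \<Rightarrow> real" where
  "energy h a y = (norm (y - a))\<^sup>2 / 2
     - h / 4 * (\<Sum>i\<in>UNIV. \<Sum>j\<in>UNIV. \<gamma> i j * ln ((y $ i - y $ j)\<^sup>2))"

text \<open>
  Coercivity. The logarithms grow at most linearly, so the quadratic term bounds \<open>y\<close>. On a bounded
  set every barrier is then bounded on one side, so on a sublevel set none of them can blow up: the
  consecutive gaps, and with them all gaps, stay away from zero.
\<close>

lemma energy_sublevel:
  assumes "h > 0"
  obtains R \<delta> where "\<delta> > 0"
    "\<And>y. y \<in> ordered_chamber \<Longrightarrow> energy h a y \<le> c \<Longrightarrow>
       norm (y - a) \<le> R \<and> (\<forall>i j. i < j \<longrightarrow> y $ j - y $ i \<ge> \<delta>)"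
proof -
  \<comment> \<open>The sum of the logarithms, weighted as in the energy, is at most \<open>K * norm y\<close>. For \<open>r = norm (y - a)\<close>
    this leaves a quadratic inequality that forces \<open>r \<le> R\<close>, and then \<open>V\<close> bounds all the logarithms.\<close>
  define K where "K = h * (\<Sum>i\<in>UNIV. \<Sum>j\<in>UNIV. \<bar>\<gamma> i j\<bar>)"
  define R where "R = 1 + 2 * (K + K * norm a + \<bar>c\<bar>)"
  define V where "V = K * (R + norm a)"
  \<comment> \<open>Solves \<open>h / 4 * \<gamma> k l * ln (w\<^sup>2) \<ge> - (\<bar>c\<bar> + V)\<close> for the gap \<open>w\<close>; the half comes from the square.\<close>
  define \<delta>' where "\<delta>' k l = exp (- (4 / (h * \<gamma> k l) * (\<bar>c\<bar> + V)) / 2)" for k l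
  define \<delta> where "\<delta> = Min (insert 1 {\<delta>' k l | k l. consecutive k l})"
  have K0: "K \<ge> 0" unfolding K_def using assms by (intro mult_nonneg_nonneg sum_nonneg) auto
  have fin: "finite {\<delta>' k l | k l. consecutive k l}"
    by (rule finite_subset[of _ "(\<lambda>(k, l). \<delta>' k l) ` UNIV"]) auto
  have "\<delta> > 0" unfolding \<delta>_def using fin by (auto simp: \<delta>'_def)
  moreover have "norm (y - a) \<le> R \<and> (\<forall>i j. i < j \<longrightarrow> y $ j - y $ i \<ge> \<delta>)"
    if y: "y \<in> ordered_chamber" "energy h a y \<le> c" for y
  proof
    define r where "r = norm (y - a)"
    define t where "t i j = \<gamma> i j * ln ((y $ i - y $ j)\<^sup>2)" for i j
    have t_le: "t i j \<le> \<bar>\<gamma> i j\<bar> * (4 * norm y)" for i j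
    proof (cases "i = j")
      case False
      then show ?thesis
        unfolding t_def abs_of_nonneg[OF nonneg[OF False]]
        by (intro mult_left_mono ln_square_le nonneg)
    qed (simp add: t_def)
    have y_norm: "norm y \<le> r + norm a"
      unfolding r_def by (metis norm_triangle_sub add.commute)
    have tsum: "h / 4 * (\<Sum>i\<in>UNIV. \<Sum>j\<in>UNIV. \<bar>\<gamma> i j\<bar> * (4 * norm y)) = K * norm y"
      unfolding K_def by (simp add: sum_distrib_right[symmetric])
    have "h / 4 * (\<Sum>i\<in>UNIV. \<Sum>j\<in>UNIV. t i j) \<le> K * norm y"
      unfolding tsum[symmetric] using assms by (intro mult_left_mono sum_mono t_le) auto
    also have "\<dots> \<le> K * (r + norm a)" using K0 y_norm by (intro mult_left_mono)
    finally have "r\<^sup>2 / 2 \<le> c + K * (r + norm a)"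
      using y(2) unfolding energy_def t_def r_def by simp
    then have r2: "r\<^sup>2 \<le> 2 * (K * r + (K * norm a + \<bar>c\<bar>))" by (simp add: algebra_simps)
    have "r \<le> R"
    proof (cases "r \<le> 1")
      case True
      then show ?thesis unfolding R_def using K0 by (smt (verit) mult_nonneg_nonneg norm_ge_zero)
    next
      case False
      have "(K * norm a + \<bar>c\<bar>) * 1 \<le> (K * norm a + \<bar>c\<bar>) * r"
        using False K0 by (intro mult_left_mono) auto
      then have "r * r \<le> (2 * (K + K * norm a + \<bar>c\<bar>)) * r"
        using r2 by (simp add: power2_eq_square algebra_simps)
      then have "r \<le> 2 * (K + K * norm a + \<bar>c\<bar>)" using False by (simp add: mult_le_cancel_right)
      then show ?thesis unfolding R_def by simp
    qed
    then show "norm (y - a) \<le> R" by (simp add: r_def)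
    have yR: "K * norm y \<le> V"
      unfolding V_def using y_norm \<open>r \<le> R\<close> K0 by (intro mult_left_mono) auto
    show "\<forall>i j. i < j \<longrightarrow> y $ j - y $ i \<ge> \<delta>"
    proof (intro allI impI)
      fix i j :: 'n assume "i < j"
      then obtain k where k: "consecutive i k" "0 < y $ k - y $ i" "y $ k - y $ i \<le> y $ j - y $ i"
        using chamber_gap[OF y(1)] by blast
      \<comment> \<open>The barrier of the consecutive pair \<open>(i, k)\<close> is isolated; all others are bounded by \<open>V\<close>.\<close>
      define w where "w = y $ k - y $ i"
      have w: "w > 0" "(y $ i - y $ k)\<^sup>2 = w\<^sup>2"
        using k by (auto simp: w_def power2_commute)
      have g: "\<gamma> i k > 0" using pos k(1) .
      have "(\<Sum>m\<in>UNIV. \<Sum>l\<in>UNIV. t m l)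
          \<le> (\<Sum>m\<in>UNIV. \<Sum>l\<in>UNIV. (if m = i \<and> l = k then t i k else 0) + \<bar>\<gamma> m l\<bar> * (4 * norm y))"
        by (intro sum_mono) (auto intro: t_le)
      also have "\<dots> = t i k + (\<Sum>m\<in>UNIV. \<Sum>l\<in>UNIV. \<bar>\<gamma> m l\<bar> * (4 * norm y))"
      proof -
        have "(\<Sum>m\<in>UNIV. \<Sum>l\<in>UNIV. (if m = i \<and> l = k then t i k else 0))
            = (\<Sum>m\<in>UNIV. if m = i then t i k else 0)"
          by (intro sum.cong refl) (simp add: sum.delta if_distrib)
        then show ?thesis by (simp add: sum.distrib)
      qed
      finally have "h / 4 * (\<Sum>m\<in>UNIV. \<Sum>l\<in>UNIV. t m l) \<le> h / 4 * t i k + K * norm y"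
        unfolding tsum[symmetric] using assms
        by (metis distrib_left mult_left_mono less_imp_le divide_pos_pos zero_less_numeral)
      moreover have "- (h / 4 * (\<Sum>m\<in>UNIV. \<Sum>l\<in>UNIV. t m l)) \<le> \<bar>c\<bar>"
        using y(2) unfolding energy_def t_def by (smt (verit) divide_nonneg_pos zero_le_power2)
      ultimately have "- (\<bar>c\<bar> + V) \<le> h / 4 * t i k" using yR by linarith
      also have "h / 4 * t i k = (h * \<gamma> i k / 4) * (2 * ln w)"
        unfolding t_def w(2) using w(1) by (simp add: ln_realpow)
      finally have "- (4 / (h * \<gamma> i k) * (\<bar>c\<bar> + V)) / 2 \<le> ln w"
        using g assms by (simp add: field_simps)
      then have "\<delta>' i k \<le> w"
        unfolding \<delta>'_def using w(1) by (simp add: exp_le_cancel_iff ln_ge_iff)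
      moreover have "\<delta> \<le> \<delta>' i k" unfolding \<delta>_def using fin k(1) by (intro Min_le) auto
      ultimately show "y $ j - y $ i \<ge> \<delta>" using k(3) unfolding w_def by linarith
    qed
  qed
  ultimately show ?thesis using that by blast
qed

lemma energy_derivative:
  assumes "y \<in> ordered_chamber"
  shows "((\<lambda>s. energy h a (y + s *\<^sub>R z)) has_real_derivative (y - a - h *\<^sub>R drift y) \<bullet> z) (at 0)"
proof -
  have ne: "y $ i - y $ j \<noteq> 0" if "i \<noteq> j" for i j
    using that assms by (cases "i < j") (force simp: ordered_chamber_def not_less_iff_gr_or_eq)+
  have D: "((\<lambda>s. \<gamma> i j * ln (((y + s *\<^sub>R z) $ i - (y + s *\<^sub>R z) $ j)\<^sup>2)) has_real_derivative
      2 * (\<gamma> i j * (z $ i - z $ j) / (y $ i - y $ j))) (at 0)" for i j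
  proof (cases "i = j")
    case False
    define w v where "w = y $ i - y $ j" and "v = z $ i - z $ j"
    have "w \<noteq> 0" using ne[OF False] by (simp add: w_def)
    have "((\<lambda>s. (w + s * v)\<^sup>2) has_real_derivative 2 * (w * v)) (at 0)"
      by (auto intro!: derivative_eq_intros)
    moreover have "(ln has_real_derivative inverse ((w + 0 * v)\<^sup>2)) (at ((w + 0 * v)\<^sup>2))"
      using \<open>w \<noteq> 0\<close> by (intro DERIV_ln) simp
    ultimately have "((\<lambda>s. ln ((w + s * v)\<^sup>2)) has_real_derivative inverse ((w + 0 * v)\<^sup>2) * (2 * (w * v))) (at 0)"
      by (rule DERIV_chain2[rotated])
    then have "((\<lambda>s. \<gamma> i j * ln ((w + s * v)\<^sup>2)) has_real_derivative
        \<gamma> i j * (inverse ((w + 0 * v)\<^sup>2) * (2 * (w * v)))) (at 0)"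
      by (rule DERIV_cmult)
    moreover have "\<gamma> i j * (inverse ((w + 0 * v)\<^sup>2) * (2 * (w * v))) = 2 * (\<gamma> i j * v / w)"
      using \<open>w \<noteq> 0\<close> by (simp add: power2_eq_square field_simps)
    ultimately have "((\<lambda>s. \<gamma> i j * ln ((w + s * v)\<^sup>2)) has_real_derivative 2 * (\<gamma> i j * v / w)) (at 0)"
      by simp
    moreover have line: "(y + s *\<^sub>R z) $ i - (y + s *\<^sub>R z) $ j = w + s * v" for s
      by (simp add: w_def v_def algebra_simps)
    ultimately show ?thesis unfolding line unfolding w_def v_def by blast
  qed simp
  have "((\<lambda>s. \<Sum>i\<in>UNIV. \<Sum>j\<in>UNIV. \<gamma> i j * ln (((y + s *\<^sub>R z) $ i - (y + s *\<^sub>R z) $ j)\<^sup>2))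
      has_real_derivative (\<Sum>i\<in>UNIV. \<Sum>j\<in>UNIV. 2 * (\<gamma> i j * (z $ i - z $ j) / (y $ i - y $ j)))) (at 0)"
    by (intro DERIV_sum D)
  also have "(\<Sum>i\<in>UNIV. \<Sum>j\<in>UNIV. 2 * (\<gamma> i j * (z $ i - z $ j) / (y $ i - y $ j))) = 4 * (drift y \<bullet> z)"
    unfolding inner_drift sum_distrib_left[symmetric] by linarith
  finally have log: "((\<lambda>s. \<Sum>i\<in>UNIV. \<Sum>j\<in>UNIV. \<gamma> i j * ln (((y + s *\<^sub>R z) $ i - (y + s *\<^sub>R z) $ j)\<^sup>2))
      has_real_derivative 4 * (drift y \<bullet> z)) (at 0)" .
  have quad: "((\<lambda>s. (norm (y + s *\<^sub>R z - a))\<^sup>2 / 2) has_real_derivative (y - a) \<bullet> z) (at 0)"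
  proof -
    have "(norm (y + s *\<^sub>R z - a))\<^sup>2 / 2 = (norm (y - a))\<^sup>2 / 2 + s * ((y - a) \<bullet> z) + s\<^sup>2 * (z \<bullet> z) / 2" for s
    proof -
      have "y + s *\<^sub>R z - a = (y - a) + s *\<^sub>R z" by simp
      then show ?thesis unfolding power2_norm_eq_inner
        by (simp only: inner_add_left inner_add_right inner_scaleR_left inner_scaleR_right
            inner_commute[of z "y - a"]) (simp add: field_simps power2_eq_square)
    qed
    then show ?thesis by (auto intro!: derivative_eq_intros)
  qed
  have "(y - a) \<bullet> z - h / 4 * (4 * (drift y \<bullet> z)) = (y - a - h *\<^sub>R drift y) \<bullet> z"
    by (simp add: inner_diff_left)
  then show ?thesis
    unfolding energy_def using DERIV_diff[OF quad DERIV_cmult[OF log, of "h / 4"]] by metis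
qed

text \<open>
  A sublevel set of the energy lies in a compact subset of the open chamber, so the energy has a
  minimizer over the chamber, at which all directional derivatives vanish.
\<close>

lemma implicit_step_exists:
  assumes "h > 0"
  obtains y where "y \<in> ordered_chamber" "y = a + h *\<^sub>R drift y"
proof -
  obtain y0 :: "real ^ 'n::{finite,linorder}" where y0: "y0 \<in> ordered_chamber" using chamber_nonempty by blast
  obtain R \<delta> where \<delta>: "\<delta> > 0" and sub: "\<And>y. y \<in> ordered_chamber \<Longrightarrow> energy h a y \<le> energy h a y0 \<Longrightarrow>
       norm (y - a) \<le> R \<and> (\<forall>i j. i < j \<longrightarrow> y $ j - y $ i \<ge> \<delta>)"
    by (rule energy_sublevel[OF assms, of a "energy h a y0"]) (rule that)
  define D where "D = cball a R \<inter> (\<Inter>i. \<Inter>j\<in>{j. i < j}. {y. \<delta> \<le> y $ j - y $ i})"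
  have DI: "y \<in> D" if "y \<in> ordered_chamber" "energy h a y \<le> energy h a y0" for y
    using sub[OF that] unfolding D_def by (auto simp: dist_norm norm_minus_commute)
  have Dc: "D \<subseteq> ordered_chamber"
    using \<delta> unfolding D_def ordered_chamber_def by force
  have "compact D"
    unfolding D_def
    by (intro compact_Int_closed compact_cball closed_INT ballI closed_Collect_le continuous_intros)
  moreover have "D \<noteq> {}" using DI[OF y0] by auto
  moreover have "continuous_on D (energy h a)"
  proof -
    have "continuous_on D (\<lambda>y. \<gamma> i j * ln ((y $ i - y $ j)\<^sup>2))" for i j
    proof (cases "i = j")
      case False
      have "y $ i - y $ j \<noteq> 0" if "y \<in> D" for y
        using that Dc False by (cases "i < j") (force simp: ordered_chamber_def not_less_iff_gr_or_eq)+
      then show ?thesis by (intro continuous_intros) auto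
    qed simp
    then have "continuous_on D (\<lambda>y. \<Sum>i\<in>UNIV. \<Sum>j\<in>UNIV. \<gamma> i j * ln ((y $ i - y $ j)\<^sup>2))"
      by (intro continuous_on_sum)
    then show ?thesis unfolding energy_def
      by (rule continuous_on_diff[OF _ continuous_on_mult_left, rotated]) (intro continuous_intros; simp)
  qed
  ultimately obtain y where y: "y \<in> D" "\<And>x. x \<in> D \<Longrightarrow> energy h a y \<le> energy h a x"
    using continuous_attains_inf[of D "energy h a"] by auto
  have yc: "y \<in> ordered_chamber" using y(1) Dc by auto
  have min: "energy h a y \<le> energy h a x" if "x \<in> ordered_chamber" for x
    using y(2)[OF DI[OF y0 order.refl]] y(2)[OF DI[OF that]] by fastforce
  have "(y - a - h *\<^sub>R drift y) \<bullet> z = 0" for z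
  proof -
    have "((\<lambda>s. y + s *\<^sub>R z) \<longlongrightarrow> y + 0 *\<^sub>R z) (at 0)" by (intro tendsto_intros)
    then have "\<forall>\<^sub>F s in at 0. y + s *\<^sub>R z \<in> ordered_chamber"
      using open_chamber yc by (auto dest: topological_tendstoD)
    then obtain e where e: "e > 0" "\<And>s. s \<noteq> 0 \<Longrightarrow> dist s 0 < e \<Longrightarrow> y + s *\<^sub>R z \<in> ordered_chamber"
      unfolding eventually_at by auto
    \<comment> \<open>Near \<open>y\<close> the line stays in the open chamber, where \<open>y\<close> is a minimizer.\<close>
    have loc: "energy h a (y + 0 *\<^sub>R z) \<le> energy h a (y + s *\<^sub>R z)" if "\<bar>0 - s\<bar> < e" for s
      using that e(2)[of s] min by (cases "s = 0") auto
    show ?thesis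
      by (rule DERIV_local_min[OF energy_derivative[OF yc] e(1)]) (use loc in auto)
  qed
  then have "y - a - h *\<^sub>R drift y = 0" by (metis inner_eq_zero_iff)
  then show ?thesis using that[OF yc] by (simp add: algebra_simps)
qed

text \<open>
  One implicit step as a function of its explicit data: the resolvent of the monotone operator
  \<open>- drift\<close>.
\<close>

definition resolvent :: "real \<Rightarrow> real ^ 'n::{finite,linorder} \<Rightarrow> real ^ 'n::{finite,linorder}" where
  "resolvent h a = (THE y. y \<in> ordered_chamber \<and> y = a + h *\<^sub>R drift y)"

lemma resolvent:
  assumes "h > 0"
  shows "resolvent h a \<in> ordered_chamber" "resolvent h a = a + h *\<^sub>R drift (resolvent h a)"
proof -
  obtain y where y: "y \<in> ordered_chamber" "y = a + h *\<^sub>R drift y"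
    using implicit_step_exists[OF assms] .
  have uniq: "x = y" if "x \<in> ordered_chamber \<and> x = a + h *\<^sub>R drift x" for x
    using implicit_step_stable[of x y h a a] that y assms by simp
  have "resolvent h a \<in> ordered_chamber \<and> resolvent h a = a + h *\<^sub>R drift (resolvent h a)"
    unfolding resolvent_def by (rule theI[of _ y]) (use y uniq in blast)+
  then show "resolvent h a \<in> ordered_chamber" "resolvent h a = a + h *\<^sub>R drift (resolvent h a)"
    by blast+
qed

lemma continuous_resolvent:
  assumes "h > 0"
  shows "continuous_on UNIV (resolvent h)"
proof (rule lipschitz_on_continuous_on)
  show "1-lipschitz_on UNIV (resolvent h)"
    by (rule lipschitz_onI)
      (use implicit_step_stable[OF resolvent(1) resolvent(1) _ resolvent(2) resolvent(2)] assms in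
        \<open>auto simp: dist_norm\<close>)
qed

lemma semi_implicit_EM_step_eq_resolvent:
  "semi_implicit_EM_step \<gamma> b s h x w =
     resolvent h (x + h *\<^sub>R (\<chi> i. b i x) + (\<chi> i. \<Sum>j\<in>UNIV. s i j x * w $ j))"
  unfolding semi_implicit_EM_step_def resolvent_def
  by (intro arg_cong[where f = The] ext) (auto simp: vec_eq_iff drift_def algebra_simps)

end

section \<open>The local error over one step\<close>

text \<open>
  For \<open>A\<close> and \<open>A'\<close> of the size of path increments over time \<open>h\<close> and \<open>B\<close>, \<open>C\<close> inverse gaps, the combination
  that bounds the oscillation of the drift is of order \<open>h powr (1 / 2)\<close> in the \<open>p\<close>-norm. The
  term with \<open>A'\<close> is the product of three factors two of which are \<open>1\<close>.
\<close>

lemma local_defect_moment: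
  fixes A A' B C :: "'a \<Rightarrow> real"
  assumes "prob_space M"
    and [measurable]: "A \<in> borel_measurable M" "A' \<in> borel_measurable M"
      "B \<in> borel_measurable M" "C \<in> borel_measurable M"
    and nonneg: "\<And>\<omega>. A \<omega> \<ge> 0" "\<And>\<omega>. A' \<omega> \<ge> 0" "\<And>\<omega>. B \<omega> \<ge> 0" "\<And>\<omega>. C \<omega> \<ge> 0"
    and const: "G \<ge> 0" "L \<ge> 0" "K \<ge> 0" "h > 0" "p \<ge> 1"
    and mA: "(\<integral>\<^sup>+\<omega>. ennreal (A \<omega> powr (3 * p)) \<partial>M) \<le> ennreal (K * h powr (3 * p / 2))"
    and mA': "(\<integral>\<^sup>+\<omega>. ennreal (A' \<omega> powr (3 * p)) \<partial>M) \<le> ennreal (K * h powr (3 * p / 2))"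
    and mB: "(\<integral>\<^sup>+\<omega>. ennreal (B \<omega> powr (3 * p)) \<partial>M) \<le> ennreal K"
    and mC: "(\<integral>\<^sup>+\<omega>. ennreal (C \<omega> powr (3 * p)) \<partial>M) \<le> ennreal K"
  shows "(\<integral>\<^sup>+\<omega>. ennreal ((G * A \<omega> * B \<omega> * C \<omega> + L * A' \<omega>) powr p) \<partial>M)
    \<le> ennreal (2 powr p * 2 powr (p - 1) * (G powr p + L powr p) * (4 * K + 2) * h powr (p / 2))"
proof -
  interpret prob_space M by fact
  define c where "c = 2 powr p * 2 powr (p - 1) * (G powr p + L powr p) * h powr (p / 2)"
  define g where "g = 1 / h powr (3 * p / 2)"
  have c0: "c \<ge> 0" and g0: "g \<ge> 0" unfolding c_def g_def by auto
  have gK: "ennreal g * ennreal (K * h powr (3 * p / 2)) = ennreal K"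
    using const by (simp add: g_def ennreal_mult'[symmetric])
  have pw: "ennreal ((G * A \<omega> * B \<omega> * C \<omega> + L * A' \<omega>) powr p)
    \<le> ennreal c * (ennreal g * ennreal (A \<omega> powr (3 * p)) + ennreal (B \<omega> powr (3 * p))
        + ennreal (C \<omega> powr (3 * p)) + ennreal g * ennreal (A' \<omega> powr (3 * p)) + 2)" for \<omega>
  proof -
    have t1: "(G * A \<omega> * B \<omega> * C \<omega>) powr p \<le> G powr p * (h powr (p / 2) *
        (g * A \<omega> powr (3 * p) + B \<omega> powr (3 * p) + C \<omega> powr (3 * p)))"
    proof -
      have "(G * A \<omega> * B \<omega> * C \<omega>) powr p = G powr p * (A \<omega> * B \<omega> * C \<omega>) powr p"
        using const nonneg by (simp add: powr_mult)
      also have "\<dots> \<le> G powr p * (h powr (p / 2) *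
        (g * A \<omega> powr (3 * p) + B \<omega> powr (3 * p) + C \<omega> powr (3 * p)))"
        using mult3_powr_le[of "A \<omega>" "B \<omega>" "C \<omega>" h p] const nonneg
        by (intro mult_left_mono) (auto simp: g_def)
      finally show ?thesis .
    qed
    have t2: "(L * A' \<omega>) powr p \<le> L powr p * (h powr (p / 2) * (g * A' \<omega> powr (3 * p) + 2))"
    proof -
      have "(L * A' \<omega>) powr p = L powr p * (A' \<omega> * 1 * 1) powr p"
        using const nonneg by (simp add: powr_mult)
      also have "\<dots> \<le> L powr p * (h powr (p / 2) * (g * A' \<omega> powr (3 * p) + 2))"
        using mult3_powr_le[of "A' \<omega>" 1 1 h p] const nonneg
        by (intro mult_left_mono) (auto simp: g_def add.assoc)
      finally show ?thesis .
    qed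
    define V where "V = g * A \<omega> powr (3 * p) + B \<omega> powr (3 * p) + C \<omega> powr (3 * p) + g * A' \<omega> powr (3 * p) + 2"
    have V: "g * A \<omega> powr (3 * p) + B \<omega> powr (3 * p) + C \<omega> powr (3 * p) \<le> V" "g * A' \<omega> powr (3 * p) + 2 \<le> V" 
      unfolding V_def using g0 nonneg by auto
    have "(G * A \<omega> * B \<omega> * C \<omega> + L * A' \<omega>) powr p
      \<le> 2 powr p * 2 powr (p - 1) * ((G * A \<omega> * B \<omega> * C \<omega>) powr p + (L * A' \<omega>) powr p)"
      using const nonneg by (intro add_powr_le mult_nonneg_nonneg) auto
    also have "\<dots> \<le> 2 powr p * 2 powr (p - 1) * (G powr p * (h powr (p / 2) * V) + L powr p * (h powr (p / 2) * V))"
      by (intro mult_left_mono add_mono order.trans[OF t1] order.trans[OF t2] V) auto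
    also have "\<dots> = c * V" unfolding c_def by (simp add: algebra_simps)
    finally have "ennreal ((G * A \<omega> * B \<omega> * C \<omega> + L * A' \<omega>) powr p) \<le> ennreal (c * V)"
      by (rule ennreal_leI)
    also have "\<dots> = ennreal c * (ennreal g * ennreal (A \<omega> powr (3 * p)) + ennreal (B \<omega> powr (3 * p))
        + ennreal (C \<omega> powr (3 * p)) + ennreal g * ennreal (A' \<omega> powr (3 * p)) + 2)"
      unfolding V_def using c0 g0 by (simp add: ennreal_mult')
    finally show ?thesis .
  qed
  have "(\<integral>\<^sup>+\<omega>. ennreal ((G * A \<omega> * B \<omega> * C \<omega> + L * A' \<omega>) powr p) \<partial>M)
    \<le> (\<integral>\<^sup>+\<omega>. ennreal c * (ennreal g * ennreal (A \<omega> powr (3 * p)) + ennreal (B \<omega> powr (3 * p))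
        + ennreal (C \<omega> powr (3 * p)) + ennreal g * ennreal (A' \<omega> powr (3 * p)) + 2) \<partial>M)"
    by (intro nn_integral_mono pw)
  also have "\<dots> = ennreal c * (ennreal g * (\<integral>\<^sup>+\<omega>. ennreal (A \<omega> powr (3 * p)) \<partial>M)
      + (\<integral>\<^sup>+\<omega>. ennreal (B \<omega> powr (3 * p)) \<partial>M) + (\<integral>\<^sup>+\<omega>. ennreal (C \<omega> powr (3 * p)) \<partial>M)
      + ennreal g * (\<integral>\<^sup>+\<omega>. ennreal (A' \<omega> powr (3 * p)) \<partial>M) + 2)"
    by (simp add: nn_integral_cmult nn_integral_add emeasure_space_1)
  also have "\<dots> \<le> ennreal c * (ennreal K + ennreal K + ennreal K + ennreal K + 2)"
    unfolding gK[symmetric]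
    by (intro mult_left_mono add_mono order.refl mA mA') (use mB mC gK in auto)
  also have "ennreal K + ennreal K + ennreal K + ennreal K + 2 = ennreal (4 * K + 2)"
    using const by (simp flip: ennreal_plus ennreal_numeral del: ennreal_plus)
  also have "ennreal c * ennreal (4 * K + 2)
      = ennreal (2 powr p * 2 powr (p - 1) * (G powr p + L powr p) * (4 * K + 2) * h powr (p / 2))"
    unfolding ennreal_mult'[OF c0, symmetric] by (simp add: c_def mult_ac)
  finally show ?thesis .
qed

context repulsion_strengths
begin

text \<open>
  Local Lipschitz continuity of the repulsion with an explicit constant, from
  \<open>1 / u - 1 / v = (v - u) / (u * v)\<close> in each pair.
\<close>

lemma repulsion_diff_le:
  assumes x: "x \<in> ordered_chamber" and y: "y \<in> ordered_chamber"
  shows "\<bar>repulsion \<gamma> i x - repulsion \<gamma> i y\<bar>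
    \<le> 2 * (\<Sum>i\<in>UNIV. \<Sum>j\<in>UNIV. \<bar>\<gamma> i j\<bar>) * norm (x - y) * inverse_gaps x * inverse_gaps y"
proof -
  define N where "N = norm (x - y) * inverse_gaps x * inverse_gaps y"
  have N0: "N \<ge> 0" unfolding N_def using inverse_gaps_nonneg[of x] inverse_gaps_nonneg[of y] by simp
  have "\<bar>\<gamma> i j / (x $ i - x $ j) - \<gamma> i j / (y $ i - y $ j)\<bar> \<le> \<bar>\<gamma> i j\<bar> * (2 * N)" for j
  proof (cases "i = j")
    case False
    define u v where "u = x $ i - x $ j" and "v = y $ i - y $ j"
    have uv: "u \<noteq> 0" "v \<noteq> 0"
      using False x y unfolding ordered_chamber_def u_def v_def
      by (cases "i < j"; force simp: not_less_iff_gr_or_eq)+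
    have "\<bar>v - u\<bar> \<le> \<bar>(x - y) $ i\<bar> + \<bar>(x - y) $ j\<bar>" unfolding u_def v_def by simp
    also have "\<dots> \<le> 2 * norm (x - y)"
      using component_le_norm_cart[of "x - y" i] component_le_norm_cart[of "x - y" j] by linarith
    finally have d: "\<bar>v - u\<bar> \<le> 2 * norm (x - y)" .
    have "\<gamma> i j / u - \<gamma> i j / v = \<gamma> i j * ((v - u) * (1 / u) * (1 / v))"
      using uv by (simp add: field_simps)
    then have "\<bar>\<gamma> i j / u - \<gamma> i j / v\<bar> = \<bar>\<gamma> i j\<bar> * (\<bar>v - u\<bar> * (1 / \<bar>u\<bar>) * (1 / \<bar>v\<bar>))"
      by (simp add: abs_mult)
    also have "\<dots> \<le> \<bar>\<gamma> i j\<bar> * (2 * norm (x - y) * inverse_gaps x * inverse_gaps y)"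
      unfolding u_def v_def
      by (intro mult_left_mono mult_mono d[unfolded u_def v_def] inverse_gap_le x y False
          mult_nonneg_nonneg inverse_gaps_nonneg) auto
    finally show ?thesis by (simp add: u_def v_def N_def mult_ac)
  qed (use N0 in simp)
  then have "\<bar>drift x $ i - drift y $ i\<bar> \<le> (\<Sum>j\<in>UNIV. \<bar>\<gamma> i j\<bar> * (2 * N))"
    unfolding drift_nth sum_subtractf[symmetric] by (intro order.trans[OF sum_abs] sum_mono)
  also have "\<dots> = (\<Sum>j\<in>UNIV. \<bar>\<gamma> i j\<bar>) * (2 * N)" by (simp add: sum_distrib_right)
  also have "\<dots> \<le> (\<Sum>i\<in>UNIV. \<Sum>j\<in>UNIV. \<bar>\<gamma> i j\<bar>) * (2 * N)"
    using N0 by (intro mult_right_mono member_le_sum[where f = "\<lambda>i. \<Sum>j\<in>UNIV. \<bar>\<gamma> i j\<bar>"] sum_nonneg) auto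
  finally show ?thesis by (simp add: drift_def N_def mult_ac)
qed

text \<open>
  What the path \<open>x\<close>, driven by \<open>w\<close>, leaves over when it is inserted into one step of the scheme from
  time \<open>s\<close> to time \<open>t\<close>: the repulsion is taken at the end and \<open>b\<close> at the beginning of the step.
\<close>

definition residual ::
  "('n \<Rightarrow> real ^ 'n::{finite,linorder} \<Rightarrow> real) \<Rightarrow> ('n \<Rightarrow> 'n \<Rightarrow> real) \<Rightarrow>
   (real \<Rightarrow> real ^ 'n::{finite,linorder}) \<Rightarrow> (real \<Rightarrow> real ^ 'n::{finite,linorder}) \<Rightarrow>
   real \<Rightarrow> real \<Rightarrow> real ^ 'n::{finite,linorder}" where
  "residual b \<sigma> w x s t = x t - x s - (t - s) *\<^sub>R (drift (x t) + (\<chi> i. b i (x s)))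
     - (\<chi> i. \<Sum>j\<in>UNIV. \<sigma> i j * (w t - w s) $ j)"

text \<open>
  A bound for the difference between the integrand of the equation at an intermediate time \<open>u\<close> and
  its frozen value, in terms of the values of the path at \<open>s\<close>, \<open>t\<close> and \<open>u\<close>.
\<close>

definition local_defect :: "real \<Rightarrow> real ^ 'n::{finite,linorder} \<Rightarrow> real ^ 'n::{finite,linorder} \<Rightarrow>
    real ^ 'n::{finite,linorder} \<Rightarrow> real" where
  "local_defect L xs xt xu = 2 * (\<Sum>i\<in>UNIV. \<Sum>j\<in>UNIV. \<bar>\<gamma> i j\<bar>) * norm (xu - xt) * inverse_gaps xu * inverse_gaps xt
     + L * norm (xu - xs)"

text \<open>
  The noise cancels because its coefficient is constant. What is left is the integral, over the
  step, of the integrand minus its frozen value. Dividing by the dimension absorbs the passage from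
  components to the norm.
\<close>

lemma residual_le:
  fixes x w :: "real \<Rightarrow> real ^ 'n::{finite,linorder}"
  assumes st: "0 \<le> s" "s \<le> t" "t \<le> T"
    and chamber: "\<And>u. u \<in> {0..T} \<Longrightarrow> x u \<in> ordered_chamber"
    and int: "\<And>i u. u \<in> {0..T} \<Longrightarrow> set_integrable lborel {0..u} (\<lambda>v. repulsion \<gamma> i (x v) + b i (x v))"
    and eq: "\<And>i u. u \<in> {0..T} \<Longrightarrow> x u $ i = x 0 $ i
          + (LINT v:{0..u}|lborel. repulsion \<gamma> i (x v) + b i (x v))
          + (\<Sum>j\<in>UNIV. \<sigma> i j * (w u $ j - w 0 $ j))"
    and lip: "\<And>i x y. \<bar>b i x - b i y\<bar> \<le> L * norm (x - y)"
  shows "ennreal (norm (residual b \<sigma> w x s t) / real CARD('n))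
    \<le> (\<integral>\<^sup>+u\<in>{s..t}. ennreal (local_defect L (x s) (x t) (x u)) \<partial>lborel)"
    (is "_ \<le> ?I")
proof -
  have comp: "ennreal \<bar>residual b \<sigma> w x s t $ i\<bar> \<le> ?I" for i
  proof -
    define f where "f v = repulsion \<gamma> i (x v) + b i (x v)" for v
    define c where "c = repulsion \<gamma> i (x t) + b i (x s)"
    have fint: "set_integrable lborel {s<..t} f"
      by (rule set_integrable_subset[OF int[of t i, folded f_def]]) (use st in auto)
    have cint: "set_integrable lborel {s<..t} (\<lambda>v. c)"
      unfolding set_integrable_def using st by (intro integrable_scaleR_left integrable_real_indicator) auto
    have "(LINT v:{0..t}|lborel. f v) = (LINT v:{0..s} \<union> {s<..t}|lborel. f v)"
      using st by (simp add: ivl_disj_un_two_touch ivl_disj_un)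
    also have "\<dots> = (LINT v:{0..s}|lborel. f v) + (LINT v:{s<..t}|lborel. f v)"
      using st by (intro set_integral_Un fint int[of s i, folded f_def]) auto
    finally have split: "(LINT v:{0..t}|lborel. f v) - (LINT v:{0..s}|lborel. f v) = (LINT v:{s<..t}|lborel. f v)"
      by simp
    have const: "(LINT v:{s<..t}|lborel. c) = (t - s) * c"
      unfolding set_lebesgue_integral_def using st by simp
    have noise: "(\<Sum>j\<in>UNIV. \<sigma> i j * (w t $ j - w 0 $ j)) - (\<Sum>j\<in>UNIV. \<sigma> i j * (w s $ j - w 0 $ j))
        = (\<Sum>j\<in>UNIV. \<sigma> i j * (w t $ j - w s $ j))"
      unfolding sum_subtractf[symmetric] by (intro sum.cong) (auto simp: algebra_simps)
    have "residual b \<sigma> w x s t $ i = (LINT v:{s<..t}|lborel. f v) - (t - s) * c"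
      unfolding residual_def split[symmetric] c_def
      using eq[of t i, folded f_def] eq[of s i, folded f_def] noise st
      by (simp add: drift_def)
    also have "\<dots> = (LINT v:{s<..t}|lborel. f v - c)"
      using set_integral_diff(2)[OF fint cint] const by simp
    finally have "ennreal \<bar>residual b \<sigma> w x s t $ i\<bar>
        = ennreal (norm (LINT v|lborel. indicator {s<..t} v *\<^sub>R (f v - c)))"
      by (simp add: set_lebesgue_integral_def)
    also have "\<dots> \<le> (\<integral>\<^sup>+v. ennreal (norm (indicator {s<..t} v *\<^sub>R (f v - c))) \<partial>lborel)"
      using set_integral_diff(1)[OF fint cint]
      by (intro integral_norm_bound_ennreal) (simp add: set_integrable_def)
    also have "\<dots> \<le> ?I"
    proof (intro nn_integral_mono)
      fix v
      have "\<bar>f v - c\<bar> \<le> local_defect L (x s) (x t) (x v)" if "v \<in> {s<..t}"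
        using repulsion_diff_le[OF chamber chamber, of v t i] lip[of i "x v" "x s"] that st
        unfolding f_def c_def local_defect_def by auto
      then show "ennreal (norm (indicator {s<..t} v *\<^sub>R (f v - c)))
          \<le> ennreal (local_defect L (x s) (x t) (x v)) * indicator {s..t} v"
        by (auto split: split_indicator intro: ennreal_leI)
    qed
    finally show ?thesis .
  qed
  show ?thesis
  proof (cases ?I rule: ennreal_cases)
    case (real I)
    then have "norm (residual b \<sigma> w x s t) \<le> (\<Sum>i\<in>(UNIV::'n set). I)"
      using comp by (intro order.trans[OF norm_le_l1_cart] sum_mono) simp
    then have "norm (residual b \<sigma> w x s t) / real CARD('n) \<le> I"
      by (simp add: divide_le_eq mult.commute)
    then show ?thesis using real by (simp add: ennreal_leI)
  qed simp
qed

text \<open>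
  The exponent is \<open>p\<close> for the integration over the step plus \<open>p / 2\<close> for the regularity of the path.
  The bounds for the three factors hold at each fixed time, so expectation and time integral are
  exchanged, for which a jointly measurable version \<open>Y\<close> of \<open>X\<close> is used.
\<close>

lemma residual_moment:
  fixes X W :: "real \<Rightarrow> 'a \<Rightarrow> real ^ 'n::{finite,linorder}"
  assumes "prob_space M"
    and T: "T > 0"
    and X: "\<And>t. t \<in> {0..T} \<Longrightarrow> X t \<in> borel_measurable M"
    and sol: "strong_solution M F W T \<gamma> b \<sigma> X"
    and lip: "\<And>i x y. \<bar>b i x - b i y\<bar> \<le> L * norm (x - y)" "L \<ge> 0"
    and p: "p \<ge> 1"
    and K: "K \<ge> 0"
    and gaps: "\<And>t. t \<in> {0..T} \<Longrightarrow> (\<integral>\<^sup>+\<omega>. ennreal (inverse_gaps (X t \<omega>) powr (3 * p)) \<partial>M) \<le> ennreal K"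
    and incr: "\<And>s t. 0 \<le> s \<Longrightarrow> s < t \<Longrightarrow> t \<le> T \<Longrightarrow>
      (\<integral>\<^sup>+\<omega>. ennreal (norm (X t \<omega> - X s \<omega>) powr (3 * p)) \<partial>M) \<le> ennreal (K * (t - s) powr (3 * p / 2))"
  shows "\<exists>Q>0. \<forall>s t. 0 \<le> s \<longrightarrow> s < t \<longrightarrow> t \<le> T \<longrightarrow>
    (\<integral>\<^sup>+\<omega>. ennreal (norm (residual b \<sigma> (\<lambda>t. W t \<omega>) (\<lambda>t. X t \<omega>) s t) powr p) \<partial>M)
      \<le> ennreal (Q * (t - s) powr (p + p / 2))"
proof -
  interpret prob_space M by fact
  interpret pair: pair_sigma_finite lborel M
    by (intro pair_sigma_finite.intro lborel.sigma_finite_measure_axioms sigma_finite_measure_axioms)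
  define d where "d = real CARD('n)"
  define G where "G = 2 * (\<Sum>i\<in>UNIV. \<Sum>j\<in>UNIV. \<bar>\<gamma> i j\<bar>)"
  define D where "D = 2 powr p * 2 powr (p - 1) * (G powr p + L powr p) * (4 * K + 2)"
  have d: "d > 0" unfolding d_def by simp
  have G: "G \<ge> 0" unfolding G_def by (intro mult_nonneg_nonneg sum_nonneg) auto
  have D: "D \<ge> 0" unfolding D_def using K by simp
  have cont: "AE \<omega> in M. continuous_on {0..T} (\<lambda>t. X t \<omega>)"
    using sol unfolding strong_solution_def by blast
  obtain Y where Ymeas: "(\<lambda>(t, \<omega>). Y t \<omega>) \<in> borel_measurable (borel \<Otimes>\<^sub>M M)"
    and YX: "AE \<omega> in M. \<forall>t\<in>{0..T}. Y t \<omega> = X t \<omega>"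
    using jointly_measurable_version[OF less_imp_le[OF T] X cont] by blast
  have Yjoint[measurable]: "(\<lambda>z. Y (fst z) (snd z)) \<in> borel_measurable (lborel \<Otimes>\<^sub>M M)"
    using Ymeas by (simp add: split_beta' cong: measurable_cong_sets sets_pair_measure_cong)
  have Yt[measurable]: "Y t \<in> borel_measurable M" for t
    using measurable_compose[OF measurable_Pair1'[of t lborel M] Yjoint] by simp
  show ?thesis
  proof (intro exI conjI allI impI)
    show "d powr p * 2 powr p * D + 1 > 0" using D by (intro add_nonneg_pos) auto
    fix s t assume st: "0 \<le> s" "s < t" "t \<le> T"
    define h where "h = t - s"
    have h: "h > 0" unfolding h_def using st by simp
    define g where "g u \<omega> = local_defect L (Y s \<omega>) (Y t \<omega>) (Y u \<omega>)" for u \<omega>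
    have g0: "g u \<omega> \<ge> 0" for u \<omega>
      unfolding g_def local_defect_def using G[unfolded G_def] lip(2) inverse_gaps_nonneg
      by (intro add_nonneg_nonneg mult_nonneg_nonneg) auto
    have gjoint[measurable]: "(\<lambda>z. g (fst z) (snd z)) \<in> borel_measurable (lborel \<Otimes>\<^sub>M M)"
      unfolding g_def local_defect_def by measurable
    have gu[measurable]: "(\<lambda>u. g u \<omega>) \<in> borel_measurable lborel" if "\<omega> \<in> space M" for \<omega>
      using measurable_compose[OF measurable_Pair2'[OF that, of lborel] gjoint] by simp
    have incr': "(\<integral>\<^sup>+\<omega>. ennreal (norm (Y u \<omega> - Y v \<omega>) powr (3 * p)) \<partial>M) \<le> ennreal (K * h powr (3 * p / 2))"
      if uv: "s \<le> v" "v \<le> t" "s \<le> u" "u \<le> t" for u v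
    proof -
      have less: "(\<integral>\<^sup>+\<omega>. ennreal (norm (X u \<omega> - X v \<omega>) powr (3 * p)) \<partial>M) \<le> ennreal (K * h powr (3 * p / 2))"
        if "s \<le> v" "v < u" "u \<le> t" for u v
      proof -
        have "(u - v) powr (3 * p / 2) \<le> h powr (3 * p / 2)"
          using that p unfolding h_def by (intro powr_mono2) auto
        then show ?thesis
          using that st K by (intro order.trans[OF incr] ennreal_leI mult_left_mono) auto
      qed
      have "(\<integral>\<^sup>+\<omega>. ennreal (norm (Y u \<omega> - Y v \<omega>) powr (3 * p)) \<partial>M)
          = (\<integral>\<^sup>+\<omega>. ennreal (norm (X u \<omega> - X v \<omega>) powr (3 * p)) \<partial>M)"
        by (intro nn_integral_cong_AE eventually_mono[OF YX]) (use uv st in auto)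
      also have "\<dots> \<le> ennreal (K * h powr (3 * p / 2))"
        using less[of v u] less[of u v] uv p
        by (cases u v rule: linorder_cases) (auto simp: norm_minus_commute)
      finally show ?thesis .
    qed
    have gaps': "(\<integral>\<^sup>+\<omega>. ennreal (inverse_gaps (Y u \<omega>) powr (3 * p)) \<partial>M) \<le> ennreal K"
      if "u \<in> {s..t}" for u
    proof -
      have "(\<integral>\<^sup>+\<omega>. ennreal (inverse_gaps (Y u \<omega>) powr (3 * p)) \<partial>M)
          = (\<integral>\<^sup>+\<omega>. ennreal (inverse_gaps (X u \<omega>) powr (3 * p)) \<partial>M)"
        by (intro nn_integral_cong_AE eventually_mono[OF YX]) (use that st in auto)
      then show ?thesis using gaps[of u] that st by simp
    qed
    have gp: "(\<lambda>(u, \<omega>). ennreal (g u \<omega> powr p) * indicator {s..t} u) \<in> borel_measurable (lborel \<Otimes>\<^sub>M M)"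
      unfolding split_beta by measurable
    have Eg: "(\<integral>\<^sup>+\<omega>. ennreal (g u \<omega> powr p) \<partial>M) \<le> ennreal (D * h powr (p / 2))" if "u \<in> {s..t}" for u
      unfolding g_def local_defect_def D_def G_def[symmetric]
      using that st by (intro local_defect_moment prob_space_axioms G lip K h p incr' gaps'
          norm_ge_zero inverse_gaps_nonneg) auto
    have path: "AE \<omega> in M. ennreal (norm (residual b \<sigma> (\<lambda>t. W t \<omega>) (\<lambda>t. X t \<omega>) s t) powr p)
        \<le> ennreal (d powr p * (2 powr p * h powr (p - 1))) * (\<integral>\<^sup>+u. ennreal (g u \<omega> powr p) * indicator {s..t} u \<partial>lborel)"
    proof -
      from sol have "AE \<omega> in M. \<forall>t\<in>{0..T}. X t \<omega> \<in> ordered_chamber"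
        "AE \<omega> in M. \<forall>i. \<forall>t\<in>{0..T}.
          set_integrable lborel {0..t} (\<lambda>s. repulsion \<gamma> i (X s \<omega>) + b i (X s \<omega>)) \<and>
          X t \<omega> $ i = X 0 \<omega> $ i
            + (LINT s:{0..t}|lborel. repulsion \<gamma> i (X s \<omega>) + b i (X s \<omega>))
            + (\<Sum>j\<in>UNIV. \<sigma> i j * (W t \<omega> $ j - W 0 \<omega> $ j))"
        unfolding strong_solution_def by blast+
      then show ?thesis using YX AE_space
      proof eventually_elim
        case (elim \<omega>)
        have chamber: "X u \<omega> \<in> ordered_chamber" if "u \<in> {0..T}" for u
          using elim(1) that by blast
        have int: "set_integrable lborel {0..u} (\<lambda>s. repulsion \<gamma> i (X s \<omega>) + b i (X s \<omega>))" if "u \<in> {0..T}" for i u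
          using elim(2) that by blast
        have eq: "X u \<omega> $ i = X 0 \<omega> $ i
            + (LINT s:{0..u}|lborel. repulsion \<gamma> i (X s \<omega>) + b i (X s \<omega>))
            + (\<Sum>j\<in>UNIV. \<sigma> i j * (W u \<omega> $ j - W 0 \<omega> $ j))" if "u \<in> {0..T}" for i u
          using elim(2) that by blast
        define R where "R = norm (residual b \<sigma> (\<lambda>t. W t \<omega>) (\<lambda>t. X t \<omega>) s t)"
        have "ennreal (R / d) \<le> (\<integral>\<^sup>+u\<in>{s..t}. ennreal (local_defect L (X s \<omega>) (X t \<omega>) (X u \<omega>)) \<partial>lborel)"
          unfolding R_def d_def
          by (rule residual_le[where x = "\<lambda>t. X t \<omega>" and w = "\<lambda>t. W t \<omega>",
                OF st(1) less_imp_le[OF st(2)] st(3) chamber int eq lip(1)])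
        also have "\<dots> = (\<integral>\<^sup>+u\<in>{s..t}. ennreal (g u \<omega>) \<partial>lborel)"
          using elim(3) st unfolding g_def
          by (intro nn_integral_cong) (auto split: split_indicator)
        finally have Rg: "ennreal (R / d) \<le> (\<integral>\<^sup>+u. ennreal (g u \<omega>) \<partial>restrict_space lborel {s..t})"
          by (simp add: nn_integral_restrict_space)
        have "ennreal ((R / d) powr p) \<le> ennreal (2 powr p * h powr (p - 1)) *
            (\<integral>\<^sup>+u. ennreal (g u \<omega> powr p) \<partial>restrict_space lborel {s..t})"
        proof (rule nn_integral_powr_Jensen[OF _ g0 _ h p _ Rg])
          show "(\<lambda>u. g u \<omega>) \<in> borel_measurable (restrict_space lborel {s..t})"
            by (rule measurable_restrict_space1[OF gu[OF elim(4)]])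
          show "emeasure (restrict_space lborel {s..t}) (space (restrict_space lborel {s..t})) = ennreal h"
            using st by (simp add: space_restrict_space emeasure_restrict_space h_def)
          show "0 \<le> R / d" unfolding R_def using d by simp
        qed
        then have "ennreal (d powr p) * ennreal ((R / d) powr p) \<le> ennreal (d powr p) *
           (ennreal (2 powr p * h powr (p - 1)) * (\<integral>\<^sup>+u. ennreal (g u \<omega> powr p) * indicator {s..t} u \<partial>lborel))"
          by (intro mult_left_mono) (auto simp: nn_integral_restrict_space)
        moreover have "ennreal (d powr p) * ennreal ((R / d) powr p) = ennreal (R powr p)"
          using d by (simp add: ennreal_mult'[symmetric] powr_divide R_def)
        ultimately show ?case by (simp add: ennreal_mult' mult.assoc R_def)
      qed
    qed
    have "(\<integral>\<^sup>+\<omega>. ennreal (norm (residual b \<sigma> (\<lambda>t. W t \<omega>) (\<lambda>t. X t \<omega>) s t) powr p) \<partial>M)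
      \<le> (\<integral>\<^sup>+\<omega>. ennreal (d powr p * (2 powr p * h powr (p - 1))) *
          (\<integral>\<^sup>+u. ennreal (g u \<omega> powr p) * indicator {s..t} u \<partial>lborel) \<partial>M)"
      by (rule nn_integral_mono_AE[OF path])
    also have "\<dots> = ennreal (d powr p * (2 powr p * h powr (p - 1))) *
          (\<integral>\<^sup>+\<omega>. (\<integral>\<^sup>+u. ennreal (g u \<omega> powr p) * indicator {s..t} u \<partial>lborel) \<partial>M)"
    proof (rule nn_integral_cmult)
      show "(\<lambda>\<omega>. \<integral>\<^sup>+u. ennreal (g u \<omega> powr p) * indicator {s..t} u \<partial>lborel) \<in> borel_measurable M"
        using measurable_pair_swap[OF gp]
        by (intro lborel.borel_measurable_nn_integral) (simp add: split_beta')
    qed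
    also have "(\<integral>\<^sup>+\<omega>. (\<integral>\<^sup>+u. ennreal (g u \<omega> powr p) * indicator {s..t} u \<partial>lborel) \<partial>M)
        = (\<integral>\<^sup>+u. (\<integral>\<^sup>+\<omega>. ennreal (g u \<omega> powr p) * indicator {s..t} u \<partial>M) \<partial>lborel)"
      by (rule pair.Fubini') (use gp in simp)
    also have "\<dots> \<le> (\<integral>\<^sup>+u. ennreal (D * h powr (p / 2)) * indicator {s..t} u \<partial>lborel)"
      by (intro nn_integral_mono) (auto split: split_indicator intro: Eg)
    also have "\<dots> = ennreal (D * h powr (p / 2)) * ennreal h"
      using st by (simp add: nn_integral_cmult h_def)
    also have "ennreal (d powr p * (2 powr p * h powr (p - 1))) * (ennreal (D * h powr (p / 2)) * ennreal h)
        = ennreal (d powr p * 2 powr p * D * h powr (p + p / 2))"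
    proof -
      have "h powr (p + p / 2) = h powr ((p - 1) + p / 2 + 1)" by (rule arg_cong[where f = "(powr) h"]) simp
      also have "\<dots> = h powr (p - 1) * h powr (p / 2) * h" using h by (simp only: powr_add powr_one)
      finally show ?thesis using h D by (simp add: ennreal_mult'[symmetric])
    qed
    also have "\<dots> \<le> ennreal ((d powr p * 2 powr p * D + 1) * (t - s) powr (p + p / 2))"
      unfolding h_def by (intro ennreal_leI mult_right_mono) auto
    finally show "(\<integral>\<^sup>+\<omega>. ennreal (norm (residual b \<sigma> (\<lambda>t. W t \<omega>) (\<lambda>t. X t \<omega>) s t) powr p) \<partial>M)
      \<le> ennreal ((d powr p * 2 powr p * D + 1) * (t - s) powr (p + p / 2))"
      by (auto simp: mult_left_mono)
  qed
qed

end

section \<open>Propagation of the local errors\<close>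

context repulsion_strengths
begin

lemma borel_measurable_drift[measurable]: "drift \<in> borel_measurable borel"
  by (rule borel_measurable_vec) (simp add: drift_nth)

lemma borel_measurable_semi_implicit_EM:
  fixes W :: "real \<Rightarrow> 'a \<Rightarrow> real ^ 'n::{finite,linorder}"
  assumes [measurable]: "\<xi> \<in> borel_measurable M" "\<And>i. b i \<in> borel_measurable borel"
    and W: "\<And>t. t \<ge> 0 \<Longrightarrow> W t \<in> borel_measurable M"
    and T: "T > 0" "n \<ge> 1"
  shows "semi_implicit_EM \<gamma> b (\<lambda>i j x. \<sigma> i j) T W \<xi> n k \<in> borel_measurable M"
proof (induction k)
  case (Suc k)
  note [measurable] = Suc
  have [measurable]: "resolvent (T / real n) \<in> borel_measurable borel"
    using T by (intro borel_measurable_continuous_onI continuous_resolvent) simp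
  have [measurable]: "W (grid T n j) \<in> borel_measurable M" for j
    using T by (intro W) (simp add: grid_def)
  have [measurable]: "(\<lambda>x. \<chi> i. b i x) \<in> borel_measurable borel"
    by (rule borel_measurable_vec) simp
  have [measurable]: "(\<lambda>w :: real ^ 'n::{finite,linorder}. \<chi> i. \<Sum>j\<in>UNIV. \<sigma> i j * w $ j) \<in> borel_measurable borel"
    by (rule borel_measurable_vec) simp
  show ?case unfolding semi_implicit_EM.simps semi_implicit_EM_step_eq_resolvent by measurable
qed simp

lemma borel_measurable_residual:
  fixes W X :: "real \<Rightarrow> 'a \<Rightarrow> real ^ 'n::{finite,linorder}"
  assumes [measurable]: "X s \<in> borel_measurable M" "X t \<in> borel_measurable M"
      "W s \<in> borel_measurable M" "W t \<in> borel_measurable M" "\<And>i. b i \<in> borel_measurable borel"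
  shows "(\<lambda>\<omega>. residual b \<sigma> (\<lambda>t. W t \<omega>) (\<lambda>t. X t \<omega>) s t) \<in> borel_measurable M"
proof -
  have [measurable]: "(\<lambda>x. \<chi> i. b i x) \<in> borel_measurable borel"
    by (rule borel_measurable_vec) simp
  have [measurable]: "(\<lambda>w :: real ^ 'n::{finite,linorder}. \<chi> i. \<Sum>j\<in>UNIV. \<sigma> i j * w $ j) \<in> borel_measurable borel"
    by (rule borel_measurable_vec) simp
  show ?thesis unfolding residual_def by measurable
qed

text \<open>
  Solution and scheme are both images of the same contraction; their data differ by the previous error, the
  difference of \<open>b\<close>, and the residual. The Gronwall factor depends on \<open>T\<close> but not on the number of
  steps.
\<close>

lemma EM_error_le_residuals:
  fixes x w :: "real \<Rightarrow> real ^ 'n::{finite,linorder}" and y :: "nat \<Rightarrow> real ^ 'n::{finite,linorder}"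
  assumes T: "T > 0" "n \<ge> 1"
    and chamber: "\<And>t. t \<in> {0..T} \<Longrightarrow> x t \<in> ordered_chamber"
    and lip: "\<And>i x y. \<bar>b i x - b i y\<bar> \<le> L * norm (x - y)" "L \<ge> 0"
    and y0: "y 0 = x 0"
    and y: "\<And>k. y (Suc k) = semi_implicit_EM_step \<gamma> b (\<lambda>i j x. \<sigma> i j) (T / real n) (y k)
        (w (grid T n (Suc k)) - w (grid T n k))"
    and k: "k \<le> n"
  shows "norm (x (grid T n k) - y k) \<le> exp (real CARD('n) * L * T) *
    (\<Sum>j<n. norm (residual b \<sigma> w x (grid T n j) (grid T n (Suc j))))"
proof -
  define h where "h = T / real n"
  define c where "c = h * (real CARD('n) * L)"
  define B where "B x = (\<chi> i. b i x)" for x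
  define r where "r j = residual b \<sigma> w x (grid T n j) (grid T n (Suc j))" for j
  have h: "h > 0" unfolding h_def using T by simp
  have c: "c \<ge> 0" unfolding c_def using h lip by simp
  have grid: "grid T n j \<in> {0..T}" if "j \<le> n" for j
    using that T by (simp add: grid_def divide_le_eq mult.commute)
  have step: "grid T n (Suc j) - grid T n j = h" for j
    unfolding grid_def h_def by (simp add: distrib_right add_divide_distrib)
  have B: "norm (B u - B v) \<le> real CARD('n) * L * norm (u - v)" for u v
  proof -
    have "norm (B u - B v) \<le> (\<Sum>i\<in>(UNIV::'n set). L * norm (u - v))"
      by (rule order.trans[OF norm_le_l1_cart sum_mono]) (simp add: B_def lip)
    then show ?thesis by simp
  qed
  have "norm (x (grid T n k) - y k) \<le> exp (c * real k) * (\<Sum>j<k. norm (r j))"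
  proof (rule discrete_Gronwall_sum[where e = "\<lambda>k. norm (x (grid T n k) - y k)", OF _ c _ _ k])
    fix j assume j: "j < n"
    define s t where "s = grid T n j" and "t = grid T n (Suc j)"
    define N where "N = (\<chi> i. \<Sum>l\<in>UNIV. \<sigma> i l * (w t - w s) $ l)"
    have "x t = (x s + h *\<^sub>R B (x s) + N + r j) + h *\<^sub>R drift (x t)"
      unfolding r_def residual_def s_def[symmetric] t_def[symmetric]
      using step[of j] by (simp add: s_def t_def N_def B_def algebra_simps)
    moreover have yres: "y (Suc j) = resolvent h (y j + h *\<^sub>R B (y j) + N)"
      unfolding y semi_implicit_EM_step_eq_resolvent by (simp add: h_def B_def N_def s_def t_def)
    moreover have "x t \<in> ordered_chamber" unfolding t_def using j by (intro chamber grid) simp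
    ultimately have "norm (x t - y (Suc j))
        \<le> norm ((x s + h *\<^sub>R B (x s) + N + r j) - (y j + h *\<^sub>R B (y j) + N))"
      using resolvent[OF h] h by (intro implicit_step_stable[of _ _ h]) auto
    also have "(x s + h *\<^sub>R B (x s) + N + r j) - (y j + h *\<^sub>R B (y j) + N)
        = (x s - y j) + h *\<^sub>R (B (x s) - B (y j)) + r j"
      by (simp add: algebra_simps)
    also have "norm \<dots> \<le> norm (x s - y j) + h * norm (B (x s) - B (y j)) + norm (r j)"
      using h by (metis norm_triangle_mono norm_triangle_ineq norm_scaleR abs_of_pos add_mono order.refl)
    also have "\<dots> \<le> norm (x s - y j) + h * (real CARD('n) * L * norm (x s - y j)) + norm (r j)"
      using h B by (intro add_mono mult_left_mono) auto
    finally show "norm (x (grid T n (Suc j)) - y (Suc j)) \<le> (1 + c) * norm (x (grid T n j) - y j) + norm (r j)"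
      by (simp add: s_def t_def c_def algebra_simps)
  qed (auto simp: y0 grid_def)
  also have "\<dots> \<le> exp (real CARD('n) * L * T) * (\<Sum>j<n. norm (r j))"
  proof (intro mult_mono sum_mono2)
    have "c * real k \<le> c * real n" using c k by (intro mult_left_mono) auto
    also have "\<dots> = real CARD('n) * L * T" unfolding c_def h_def using T by simp
    finally show "exp (c * real k) \<le> exp (real CARD('n) * L * T)" by simp
  qed (use k in \<open>auto intro: sum_nonneg\<close>)
  finally show ?thesis unfolding r_def .
qed

end

section \<open>The strong rate one half\<close>

theorem theorem2p8:
  fixes M :: "'a measure"
    and F :: "real \<Rightarrow> 'a measure"
    and W X :: "real \<Rightarrow> 'a \<Rightarrow> real ^ 'n::{finite,linorder}"
    and T p C_hat :: real
    and \<gamma> \<sigma> :: "'n \<Rightarrow> 'n \<Rightarrow> real"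
    and b :: "'n \<Rightarrow> real ^ 'n::{finite,linorder} \<Rightarrow> real"
  assumes dim: "CARD('n) \<ge> 2"
    and T: "T > 0"
    and prob: "prob_space M"
    and filt: "usual_conditions M F"
    and BM: "standard_brownian_motion M F W"
    and A1: "AE \<omega> in M. X 0 \<omega> \<in> ordered_chamber"
    and A2_sym: "\<And>i j. i \<noteq> j \<Longrightarrow> \<gamma> i j = \<gamma> j i"
    and A2_nonneg: "\<And>i j. i \<noteq> j \<Longrightarrow> \<gamma> i j \<ge> 0"
    and A2_pos: "\<And>i j. consecutive i j \<Longrightarrow> \<gamma> i j > 0"
    and A3: "\<And>i. \<exists>L. L-lipschitz_on UNIV (b i)"
    and sol: "unique_strong_solution M F W T \<gamma> b \<sigma> X"
    and p: "p \<ge> 1"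
    and C_hat: "C_hat > 0"
    and moments: "moment_sum M T (3 * p) X < ennreal C_hat"
    and increments: "\<And>s t. 0 \<le> s \<Longrightarrow> s < t \<Longrightarrow> t \<le> T \<Longrightarrow>
      (\<integral>\<^sup>+\<omega>. ennreal (norm (X t \<omega> - X s \<omega>) powr (3 * p)) \<partial>M)
        \<le> ennreal (C_hat * \<bar>t - s\<bar> powr (3 * p / 2))"
  shows "\<exists>C>0. \<forall>n\<ge>1.
    integrable M (\<lambda>\<omega>. MAX k\<in>{1..n}.
      norm (X (grid T n k) \<omega>
        - semi_implicit_EM \<gamma> b (\<lambda>i j x. \<sigma> i j) T W (X 0) n k \<omega>) powr p) \<and>
    (\<integral>\<omega>. (MAX k\<in>{1..n}.
      norm (X (grid T n k) \<omega>
        - semi_implicit_EM \<gamma> b (\<lambda>i j x. \<sigma> i j) T W (X 0) n k \<omega>) powr p) \<partial>M) powr (1 / p)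
      \<le> C / real n powr (1 / 2)"
proof -
  interpret prob_space M by fact
  interpret repulsion_strengths \<gamma>
    by unfold_locales (fact A2_sym, fact A2_nonneg, fact A2_pos)
  have strong: "strong_solution M F W T \<gamma> b \<sigma> X"
    using sol unfolding unique_strong_solution_def by blast
  have sub: "borel_measurable (F t) \<subseteq> borel_measurable M" if "t \<ge> 0" for t
    using filt that unfolding usual_conditions_def by (auto intro: measurable_from_subalg)
  have X_meas: "X t \<in> borel_measurable M" if "t \<in> {0..T}" for t
    using strong sub[of t] that unfolding strong_solution_def by auto
  have W_meas: "W t \<in> borel_measurable M" if "t \<ge> 0" for t
    using BM sub[of t] that unfolding standard_brownian_motion_def by auto
  have chamber: "AE \<omega> in M. \<forall>t\<in>{0..T}. X t \<omega> \<in> ordered_chamber"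
    using strong unfolding strong_solution_def by blast

  obtain Lf :: "'n \<Rightarrow> real" where Lf: "\<And>i. (Lf i)-lipschitz_on UNIV (b i)" using A3 by metis
  define L where "L = (\<Sum>i\<in>UNIV. Lf i)"
  have Lf0: "Lf i \<ge> 0" for i using Lf lipschitz_on_nonneg by blast
  have L0: "L \<ge> 0" unfolding L_def using Lf0 by (intro sum_nonneg)
  have lip: "\<bar>b i x - b i y\<bar> \<le> L * norm (x - y)" for i x y
  proof -
    have "\<bar>b i x - b i y\<bar> \<le> Lf i * norm (x - y)"
      using lipschitz_onD[OF Lf, of x y i] by (simp add: dist_norm)
    also have "\<dots> \<le> L * norm (x - y)"
      unfolding L_def using Lf0 by (intro mult_right_mono member_le_sum) auto
    finally show ?thesis .
  qed
  have b_meas: "b i \<in> borel_measurable borel" for i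
    using lipschitz_on_continuous_on[OF Lf] by (rule borel_measurable_continuous_onI)

  have "\<exists>K. \<forall>t\<in>{0..T}. (\<integral>\<^sup>+\<omega>. ennreal (inverse_gaps (X t \<omega>) powr (3 * p)) \<partial>M) \<le> ennreal K"
    using p by (intro inverse_gaps_moment[OF X_meas less_imp_le[OF moments] C_hat]) auto
  then obtain K0 where K0: "\<And>t. t \<in> {0..T} \<Longrightarrow>
      (\<integral>\<^sup>+\<omega>. ennreal (inverse_gaps (X t \<omega>) powr (3 * p)) \<partial>M) \<le> ennreal K0"
    by blast
  \<comment> \<open>One constant for the moments of the inverse gaps and of the increments.\<close>
  define K where "K = max K0 C_hat"
  have gaps: "(\<integral>\<^sup>+\<omega>. ennreal (inverse_gaps (X t \<omega>) powr (3 * p)) \<partial>M) \<le> ennreal K"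
    if "t \<in> {0..T}" for t
    using that by (intro order.trans[OF K0] ennreal_leI) (auto simp: K_def)
  have incr: "(\<integral>\<^sup>+\<omega>. ennreal (norm (X t \<omega> - X s \<omega>) powr (3 * p)) \<partial>M) \<le> ennreal (K * (t - s) powr (3 * p / 2))"
    if "0 \<le> s" "s < t" "t \<le> T" for s t
  proof (rule order.trans[OF increments[OF that] ennreal_leI])
    show "C_hat * \<bar>t - s\<bar> powr (3 * p / 2) \<le> K * (t - s) powr (3 * p / 2)"
      using that C_hat by (intro mult_mono) (auto simp: K_def)
  qed
  have K: "K \<ge> 0" unfolding K_def using C_hat by simp
  have "\<exists>Q>0. \<forall>s t. 0 \<le> s \<longrightarrow> s < t \<longrightarrow> t \<le> T \<longrightarrow>
    (\<integral>\<^sup>+\<omega>. ennreal (norm (residual b \<sigma> (\<lambda>t. W t \<omega>) (\<lambda>t. X t \<omega>) s t) powr p) \<partial>M)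
      \<le> ennreal (Q * (t - s) powr (p + p / 2))"
    by (rule residual_moment[OF prob T X_meas strong lip L0 p K gaps incr])
  then obtain Q where Q: "Q > 0" and res: "\<And>s t. 0 \<le> s \<Longrightarrow> s < t \<Longrightarrow> t \<le> T \<Longrightarrow>
    (\<integral>\<^sup>+\<omega>. ennreal (norm (residual b \<sigma> (\<lambda>t. W t \<omega>) (\<lambda>t. X t \<omega>) s t) powr p) \<partial>M)
      \<le> ennreal (Q * (t - s) powr (p + p / 2))"
    by blast

  define A where "A = exp (real CARD('n) * L * T) powr p * 2 powr p"
  define V where "V = A * Q * T powr p"
  have A: "A > 0" unfolding A_def by simp
  have V: "V > 0" unfolding V_def using A Q T by simp
  show ?thesis
  proof (intro exI[of _ "V powr (1 / p) * T powr (1 / 2)"] conjI allI impI)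
    show "V powr (1 / p) * T powr (1 / 2) > 0" using V T by simp
    fix n :: nat assume n: "n \<ge> 1"
    define h where "h = T / real n"
    define E where "E = (\<lambda>\<omega>. MAX k\<in>{1..n}. norm (X (grid T n k) \<omega>
        - semi_implicit_EM \<gamma> b (\<lambda>i j x. \<sigma> i j) T W (X 0) n k \<omega>) powr p)"
    define r where "r j \<omega> = norm (residual b \<sigma> (\<lambda>t. W t \<omega>) (\<lambda>t. X t \<omega>) (grid T n j) (grid T n (Suc j)))" for j \<omega>
    have h: "h > 0" unfolding h_def using T n by simp
    have grid: "grid T n j \<in> {0..T}" if "j \<le> n" for j
      using that T n by (simp add: grid_def divide_le_eq mult.commute)
    have step: "grid T n (Suc j) - grid T n j = h" for j
      unfolding grid_def h_def by (simp add: distrib_right add_divide_distrib)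
    have r_meas[measurable]: "r j \<in> borel_measurable M" if "j < n" for j
      unfolding r_def using that grid[of j] grid[of "Suc j"]
      by (intro measurable_compose[OF _ borel_measurable_norm] borel_measurable_residual
          X_meas W_meas b_meas) auto
    have r_mom: "(\<integral>\<^sup>+\<omega>. ennreal (r j \<omega> powr p) \<partial>M) \<le> ennreal (Q * h powr (p + p / 2))" if "j < n" for j
      unfolding r_def step[of j, symmetric]
      using that grid[of j] grid[of "Suc j"] step[of j] h by (intro res) auto
    have E_meas: "E \<in> borel_measurable M"
      unfolding E_def
    proof (intro borel_measurable_Max)
      fix k assume "k \<in> {1..n}"
      then have [measurable]: "X (grid T n k) \<in> borel_measurable M" using grid[of k] by (intro X_meas) auto
      have [measurable]: "semi_implicit_EM \<gamma> b (\<lambda>i j x. \<sigma> i j) T W (X 0) n k \<in> borel_measurable M"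
        using T n by (intro borel_measurable_semi_implicit_EM b_meas W_meas X_meas) auto
      show "(\<lambda>\<omega>. norm (X (grid T n k) \<omega> - semi_implicit_EM \<gamma> b (\<lambda>i j x. \<sigma> i j) T W (X 0) n k \<omega>) powr p)
          \<in> borel_measurable M"
        by measurable
    qed simp
    have E0: "E \<omega> \<ge> 0" for \<omega>
      unfolding E_def using n by (subst Max_ge_iff) auto
    have E_le: "AE \<omega> in M. ennreal (E \<omega>) \<le> ennreal (A * real n powr (p - 1)) * (\<Sum>j<n. ennreal (r j \<omega> powr p))"
      using chamber
    proof eventually_elim
      case (elim \<omega>)
      define S where "S = (\<Sum>j<n. r j \<omega>)"
      have S: "S \<ge> 0" unfolding S_def r_def by (intro sum_nonneg) auto
      have "norm (X (grid T n k) \<omega> - semi_implicit_EM \<gamma> b (\<lambda>i j x. \<sigma> i j) T W (X 0) n k \<omega>)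
          \<le> exp (real CARD('n) * L * T) * S" if "k \<le> n" for k
        unfolding S_def r_def
        by (rule EM_error_le_residuals[where x = "\<lambda>t. X t \<omega>" and w = "\<lambda>t. W t \<omega>"
              and y = "\<lambda>k. semi_implicit_EM \<gamma> b (\<lambda>i j x. \<sigma> i j) T W (X 0) n k \<omega>",
              OF T n _ lip L0 _ _ that]) (use elim in auto)
      then have "E \<omega> \<le> (exp (real CARD('n) * L * T) * S) powr p"
        unfolding E_def using n p by (subst Max_le_iff) (auto intro!: powr_mono2)
      also have "\<dots> = exp (real CARD('n) * L * T) powr p * S powr p"
        using S by (simp add: powr_mult)
      also have "\<dots> \<le> exp (real CARD('n) * L * T) powr p
          * (2 powr p * real n powr (p - 1) * (\<Sum>j<n. r j \<omega> powr p))"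
      proof (rule mult_left_mono)
        show "S powr p \<le> 2 powr p * real n powr (p - 1) * (\<Sum>j<n. r j \<omega> powr p)"
          unfolding S_def using sum_powr_le[of "{..<n}" "\<lambda>j. r j \<omega>" p] n p
          by (simp add: r_def lessThan_empty_iff)
      qed simp
      finally have "E \<omega> \<le> A * real n powr (p - 1) * (\<Sum>j<n. r j \<omega> powr p)"
        unfolding A_def by (simp add: mult_ac)
      from ennreal_leI[OF this]
      show "ennreal (E \<omega>) \<le> ennreal (A * real n powr (p - 1)) * (\<Sum>j<n. ennreal (r j \<omega> powr p))"
        using A by (simp add: ennreal_mult' sum_ennreal)
    qed
    have "(\<integral>\<^sup>+\<omega>. ennreal (E \<omega>) \<partial>M)
        \<le> (\<integral>\<^sup>+\<omega>. ennreal (A * real n powr (p - 1)) * (\<Sum>j<n. ennreal (r j \<omega> powr p)) \<partial>M)"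
      by (rule nn_integral_mono_AE[OF E_le])
    also have "\<dots> = ennreal (A * real n powr (p - 1)) * (\<integral>\<^sup>+\<omega>. (\<Sum>j<n. ennreal (r j \<omega> powr p)) \<partial>M)"
      by (intro nn_integral_cmult borel_measurable_sum) (use r_meas in measurable)
    also have "(\<integral>\<^sup>+\<omega>. (\<Sum>j<n. ennreal (r j \<omega> powr p)) \<partial>M) = (\<Sum>j<n. \<integral>\<^sup>+\<omega>. ennreal (r j \<omega> powr p) \<partial>M)"
      by (intro nn_integral_sum) (use r_meas in measurable)
    also have "\<dots> \<le> (\<Sum>j<n. ennreal (Q * h powr (p + p / 2)))"
      by (intro sum_mono r_mom) simp
    also have "\<dots> = ennreal (real n * (Q * h powr (p + p / 2)))"
      using Q by (simp add: ennreal_mult' ennreal_of_nat_eq_real_of_nat)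
    also have "ennreal (A * real n powr (p - 1)) * \<dots> = ennreal (V * h powr (p / 2))"
    proof -
      \<comment> \<open>The powers of \<open>n\<close> and \<open>h\<close> combine to \<open>(n h) powr p = T powr p\<close>, which leaves \<open>h powr (p / 2)\<close>.\<close>
      have "real n powr (p - 1) * real n * (h powr (p + p / 2)) = real n powr p * (h powr p * h powr (p / 2))"
        using n by (simp only: powr_add powr_diff) simp
      also have "\<dots> = (real n * h) powr p * h powr (p / 2)"
        using h by (simp add: powr_mult)
      also have "real n * h = T" unfolding h_def using n by simp
      finally have "A * real n powr (p - 1) * (real n * (Q * h powr (p + p / 2))) = V * h powr (p / 2)"
        unfolding V_def by (simp add: mult_ac)
      then show ?thesis using A by (simp add: ennreal_mult'[symmetric])
    qed
    finally have bound: "(\<integral>\<^sup>+\<omega>. ennreal (E \<omega>) \<partial>M) \<le> ennreal (V * h powr (p / 2))"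
      by (auto simp: mult_left_mono)
    have int: "integrable M E"
      using E_meas E0 bound
      by (intro integrableI_nonneg) (auto intro: le_less_trans[OF bound])
    then show "integrable M (\<lambda>\<omega>. MAX k\<in>{1..n}. norm (X (grid T n k) \<omega>
        - semi_implicit_EM \<gamma> b (\<lambda>i j x. \<sigma> i j) T W (X 0) n k \<omega>) powr p)"
      unfolding E_def .
    have "ennreal (\<integral>\<omega>. E \<omega> \<partial>M) \<le> ennreal (V * h powr (p / 2))"
      using bound nn_integral_eq_integral[OF int] E0 by simp
    then have "(\<integral>\<omega>. E \<omega> \<partial>M) \<le> V * h powr (p / 2)"
      using V by (subst (asm) ennreal_le_iff) auto
    then have "(\<integral>\<omega>. E \<omega> \<partial>M) powr (1 / p) \<le> (V * h powr (p / 2)) powr (1 / p)"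
      using E0 p by (intro powr_mono2 integral_nonneg_AE) auto
    also have "\<dots> = V powr (1 / p) * h powr (1 / 2)"
      using V h p by (simp add: powr_mult powr_powr)
    also have "\<dots> = V powr (1 / p) * T powr (1 / 2) / real n powr (1 / 2)"
      unfolding h_def using T by (simp add: powr_divide)
    finally show "(\<integral>\<omega>. (MAX k\<in>{1..n}. norm (X (grid T n k) \<omega>
        - semi_implicit_EM \<gamma> b (\<lambda>i j x. \<sigma> i j) T W (X 0) n k \<omega>) powr p) \<partial>M) powr (1 / p)
      \<le> V powr (1 / p) * T powr (1 / 2) / real n powr (1 / 2)"
      unfolding E_def .
  qed
qed

end
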